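(* Let $\tau,\lambda_1,\lambda_2$ satisfy $\tau>1$, $\lambda_1,\lambda_2<0$, $1+\tau(1+\lambda_i)>0$ for $i=1,2$, and $1+\tau(\lambda_1+\lambda_2)<0$, and let $q$ belong to the strip $$\max\Big\{\tfrac12\bigl(1+\tau(1+\lambda_1+\lambda_2)\bigr),\ 1+\tau(1+\lambda_1+\lambda_2)\Big\}<\Re(q)<\min\Big\{\tau,\ 1+\tau(1+\lambda_1),\ 1+\tau(1+\lambda_2)\Big\}.$$ The function $\mathfrak{CM}(q\,|\,\tau,\lambda_1,\lambda_2)$ (defined in the context) satisfies the following involution invariance under $$\tau\to\frac1\tau,\qquad q\to\frac q\tau,\qquad \lambda_i\to\tau\lambda_i:$$ $$\mathfrak{CM}\Bigl(\frac q\tau\,\Big|\,\frac1\tau,\tau\lambda_1,\tau\lambda_2\Bigr)\,\Bigl(\frac{\Gamma(1-\tau)}{\pi\,\Gamma(\tau)}\Bigr)^{\frac q\tau}\,\Gamma\bigl(1-\tfrac q\tau\bigr)=\mathfrak{CM}(q\,|\,\tau,\lambda_1,\lambda_2)\,\Bigl(\frac{\Gamma(1-\frac1\tau)}{\pi\,\Gamma(\frac1\tau)}\Bigr)^{q}\,\Gamma(1-q).$$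
   Context: $\Gamma$ is Euler's gamma function. For $\tau>0$, $\Gamma_2(w|\tau)$ denotes the Barnes double gamma function with parameters $(1,\tau)$: for $\Re(w)>0$, $\Gamma_2(w|\tau)=\exp\bigl(\partial_s\zeta_2(s,w)|_{s=0}\bigr)$, where $\zeta_2(s,w)$ is the analytic continuation in $s$ of $\sum_{k_1,k_2=0}^\infty (w+k_1+k_2\tau)^{-s}$ ($\Re(s)>2$). It extends to a meromorphic function of $w\in\mathbb{C}$ without zeros and with poles at $w=-(k_1+k_2\tau)$, $k_1,k_2=0,1,2,\dots$. The function $\mathfrak{CM}$ (the analytic continuation of the complex Selberg, or Dotsenko-Fateev, integral from integer to complex dimension $q$) is given by $$\begin{aligned}\mathfrak{CM}(q\,|\,\tau,\lambda_1,\lambda_2)=&\Bigl(\frac{\Gamma(1/\tau)\,\pi\,\tau^{1/\tau}}{\Gamma(1-1/\tau)}\Bigr)^q\,\Gamma\bigl(1-\tfrac q\tau\bigr)\,\frac{\Gamma_2(1-q+\tau(1+\lambda_1)|\tau)}{\Gamma_2(1+\tau(1+\lambda_1)|\tau)}\,\frac{\Gamma_2(1-q+\tau(1+\lambda_2)|\tau)}{\Gamma_2(1+\tau(1+\lambda_2)|\tau)}\\&\times\frac{\Gamma_2(1-q+\tau|\tau)}{\Gamma_2(1+\tau|\tau)}\,\frac{\Gamma_2(2-q+\tau(2+\lambda_1+\lambda_2)|\tau)}{\Gamma_2(2-2q+\tau(2+\lambda_1+\lambda_2)|\tau)}\,\frac{\Gamma_2(q+1+\tau|\tau)}{\Ga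mma_2(1+\tau|\tau)}\\&\times\frac{\Gamma_2(q-\tau\lambda_1|\tau)}{\Gamma_2(-\tau\lambda_1|\tau)}\,\frac{\Gamma_2(q-\tau\lambda_2|\tau)}{\Gamma_2(-\tau\lambda_2|\tau)}\,\frac{\Gamma_2(q-1-\tau(1+\lambda_1+\lambda_2)|\tau)}{\Gamma_2(2q-1-\tau(1+\lambda_1+\lambda_2)|\tau)}.\end{aligned}$$
   Formalization: On the left, both powers involving Γ(1−τ) use one common (arbitrary) value of log Γ(1−τ), since principal powers fail when Γ(1−τ)<0; for integer τ, where Γ(1−τ) is infinite, the left side is read as the limit of the parameter tending to τ. *)

theory Defs
  imports "HOL-Complex_Analysis.Complex_Analysis"
begin

text \<open>
  The continuation in \<open>s\<close> has poles at \<open>1\<close> and \<open>2\<close> only, and by the identity theorem it is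
  uniquely determined elsewhere; the choice operator fixes nothing but the irrelevant values at
  these two points. For \<open>Re w > 0\<close> every \<open>w + k\<^sub>1 + k\<^sub>2 \<tau>\<close> lies in the right half-plane, where
  \<open>powr\<close> is the principal power.
\<close>

definition barnes_zeta2 :: "real \<Rightarrow> complex \<Rightarrow> complex \<Rightarrow> complex" where
  "barnes_zeta2 \<tau> w = (SOME Z. Z holomorphic_on (- {1, 2}) \<and>
     (\<forall>s. Re s > 2 \<longrightarrow>
        Z s = (\<Sum>\<^sub>\<infinity>(k1, k2)\<in>(UNIV :: (nat \<times> nat) set).
                 (w + of_nat k1 + of_nat k2 * of_real \<tau>) powr (- s))))"

definition barnes_Gamma2_right :: "real \<Rightarrow> complex \<Rightarrow> complex" where
  "barnes_Gamma2_right \<tau> w = exp (deriv (barnes_zeta2 \<tau> w) 0)"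

text \<open>
  Off the right half-plane the value is that of the meromorphic extension, which is unique because
  \<^const>\<open>nicely_meromorphic_on\<close> fixes the value \<open>0\<close> at poles and removes removable singularities.
\<close>

definition barnes_Gamma2 :: "real \<Rightarrow> complex \<Rightarrow> complex" where
  "barnes_Gamma2 \<tau> w =
     (if Re w > 0 then barnes_Gamma2_right \<tau> w
      else (SOME G. G nicely_meromorphic_on UNIV \<and>
                    (\<forall>z. Re z > 0 \<longrightarrow> G z = barnes_Gamma2_right \<tau> z)) w)"

text \<open>All factors of \<open>CM\<close> except the first one, the \<open>q\<close>-th power.\<close>

definition CM_factors :: "complex \<Rightarrow> real \<Rightarrow> real \<Rightarrow> real \<Rightarrow> complex" where
  "CM_factors q \<tau> l1 l2 =
     (let G = barnes_Gamma2 \<tau>;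
          t = complex_of_real \<tau>; m1 = complex_of_real l1; m2 = complex_of_real l2
      in Gamma (1 - q / t)
       * (G (1 - q + t * (1 + m1)) / G (1 + t * (1 + m1)))
       * (G (1 - q + t * (1 + m2)) / G (1 + t * (1 + m2)))
       * (G (1 - q + t) / G (1 + t))
       * (G (2 - q + t * (2 + m1 + m2)) / G (2 - 2 * q + t * (2 + m1 + m2)))
       * (G (q + 1 + t) / G (1 + t))
       * (G (q - t * m1) / G (- (t * m1)))
       * (G (q - t * m2) / G (- (t * m2)))
       * (G (q - 1 - t * (1 + m1 + m2)) / G (2 * q - 1 - t * (1 + m1 + m2))))"

definition CM :: "complex \<Rightarrow> real \<Rightarrow> real \<Rightarrow> real \<Rightarrow> complex" where
  "CM q \<tau> l1 l2 =
     complex_of_real (Gamma (1 / \<tau>) * pi * \<tau> powr (1 / \<tau>) / Gamma (1 - 1 / \<tau>)) powr q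
       * CM_factors q \<tau> l1 l2"

text \<open>
  For \<open>\<tau> < 1\<close> the number \<open>Gamma (1 - 1 / \<tau>)\<close> may be negative, and then the power in \<open>CM\<close> depends
  on a branch. In \<open>CM_branch\<close> the argument \<open>g\<close> is the chosen value of \<open>log (Gamma (1 - 1 / \<tau>))\<close>;
  the other constants in the base are positive and have their real logarithm.
\<close>

definition CM_branch :: "complex \<Rightarrow> complex \<Rightarrow> real \<Rightarrow> real \<Rightarrow> real \<Rightarrow> complex" where
  "CM_branch g q \<tau> l1 l2 =
     exp (q * (complex_of_real (ln (Gamma (1 / \<tau>) * pi * \<tau> powr (1 / \<tau>))) - g))
       * CM_factors q \<tau> l1 l2"

lemma CM_eq_CM_branch:
  assumes "\<tau> > 1"
  shows "CM q \<tau> l1 l2 = CM_branch (complex_of_real (ln (Gamma (1 - 1 / \<tau>)))) q \<tau> l1 l2"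
proof -
  have a: "Gamma (1 / \<tau>) * pi * \<tau> powr (1 / \<tau>) > 0"
    using assms by (intro mult_pos_pos Gamma_real_pos) auto
  have b: "Gamma (1 - 1 / \<tau>) > 0"
    using assms by (intro Gamma_real_pos) (simp add: field_simps)
  have "Ln (complex_of_real (Gamma (1 / \<tau>) * pi * \<tau> powr (1 / \<tau>) / Gamma (1 - 1 / \<tau>)))
      = complex_of_real (ln (Gamma (1 / \<tau>) * pi * \<tau> powr (1 / \<tau>) / Gamma (1 - 1 / \<tau>)))"
    by (rule Ln_of_real) (rule divide_pos_pos[OF a b])
  also have "\<dots> = complex_of_real (ln (Gamma (1 / \<tau>) * pi * \<tau> powr (1 / \<tau>)))
                 - complex_of_real (ln (Gamma (1 - 1 / \<tau>)))"
    by (subst ln_divide_pos[OF a b]) simp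
  finally show ?thesis
    using divide_pos_pos[OF a b] unfolding CM_def CM_branch_def powr_def by auto
qed

end

theory Submission
  imports Defs
begin

text \<open>
  The scaled series \<open>\<Sum> (w / \<tau> + k\<^sub>1 + k\<^sub>2 / \<tau>)\<^sup>-\<^sup>s\<close> is \<open>\<tau>\<^sup>s\<close> times \<open>\<zeta>\<^sub>2(s, w | \<tau>)\<close> with the two summation
  indices exchanged, so by the identity theorem the same relation holds between the
  continuations. Differentiating at \<open>s = 0\<close> gives
  \<open>\<Gamma>\<^sub>2(w / \<tau> | 1 / \<tau>) = \<tau>\<^bsup>\<zeta>\<^sub>2(0, w | \<tau>)\<^esup> \<Gamma>\<^sub>2(w | \<tau>)\<close>, where \<open>\<zeta>\<^sub>2(0, w | \<tau>)\<close> is the quadratic polynomial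
  \<open>(w\<^sup>2 - (1 + \<tau>) w) / (2 \<tau>)\<close> plus a constant that cancels in every quotient of two \<open>\<Gamma>\<^sub>2\<close>.

  Under the involution each argument \<open>w\<close> of a double gamma function in \<open>CM\<close> becomes \<open>w / \<tau>\<close>, the
  two single gamma factors \<open>\<Gamma>(1 - q)\<close> and \<open>\<Gamma>(1 - q / \<tau>)\<close> change places, and the eight quotients
  contribute the total power \<open>\<tau>\<^bsup>q (1 + \<tau>) / \<tau>\<^esup>\<close>. The elementary prefactors account for the powers
  \<open>\<tau>\<^sup>-\<^sup>q\<close> on one side and \<open>\<tau>\<^bsup>q / \<tau>\<^esup>\<close> on the other, which is the same discrepancy. The branch of
  \<open>log \<Gamma>(1 - \<tau>)\<close> enters the left side twice with opposite signs and disappears. The strip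
  condition puts all arguments of \<open>\<Gamma>\<^sub>2\<close> into the right half-plane. At integer \<open>\<tau>\<close> the assertion is
  about a limit, and it follows since \<open>\<Gamma>\<^sub>2(w | \<tau>)\<close> is continuous in both variables.

  What has to be built is the continuation of \<open>\<zeta>\<^sub>2\<close>, in a form that shows its value at \<open>0\<close> and its
  continuity in \<open>(s, w, \<tau>)\<close>. Let \<open>\<Delta> f(v) = f(v) - f(v + 1) - f(v + \<tau>) + f(v + 1 + \<tau>)\<close>. If \<open>f\<close>
  vanishes at infinity, then the sum of \<open>\<Delta> f\<close> over the lattice points \<open>w + k\<^sub>1 + k\<^sub>2 \<tau>\<close> telescopes
  to \<open>f(w)\<close>. In terms of \<open>D = d/dv\<close>, \<open>\<Delta> = (1 - e\<^sup>D) (1 - e\<^bsup>\<tau> D\<^esup>)\<close>, and the Laurent coefficients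
  \<open>c\<^sub>j\<close> of \<open>1 / ((1 - e\<^sup>-\<^sup>x) (1 - e\<^bsup>-\<tau> x\<^esup>)) = \<Sum> c\<^sub>j x\<^bsup>j - 2\<^esup>\<close> invert it up to any order: with
  \<open>e\<^sub>j(v) = \<Gamma>(s + j - 2) / \<Gamma>(s) v\<^bsup>2 - s - j\<^esup>\<close>, for which \<open>D e\<^sub>j = - e\<^bsub>j + 1\<^esub>\<close>, the finite sum
  \<open>P\<^sub>L = \<Sum>\<^bsub>j \<le> L\<^esub> c\<^sub>j e\<^sub>j\<close> satisfies \<open>\<Delta> P\<^sub>L(v) = v\<^sup>-\<^sup>s - R\<^sub>L(v)\<close> with a remainder
  \<open>R\<^sub>L(v) = O(\<bar>v\<bar>\<^bsup>1 - L - Re s\<^esup>)\<close>. Hence \<open>\<zeta>\<^sub>2(s, w) = P\<^sub>L(w) + \<Sum> R\<^sub>L(w + k\<^sub>1 + k\<^sub>2 \<tau>)\<close>, and the right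
  side converges locally uniformly in all variables as long as \<open>Re s > 3 - L\<close>. At \<open>s = 0\<close> the
  functions \<open>e\<^sub>j\<close> are \<open>v\<^sup>2 / 2\<close>, \<open>- v\<close>, \<open>1\<close>, \<open>0\<close>, \<open>0\<close>, \<open>\<dots>\<close>, the remainder vanishes identically, and
  \<open>\<zeta>\<^sub>2(0, w) = c\<^sub>0 w\<^sup>2 / 2 - c\<^sub>1 w + c\<^sub>2\<close>.
\<close>

unbundle no vec_syntax

section \<open>Coefficients of the generating function\<close>

text \<open>
  The Todd series \<open>x / (1 - e\<^sup>-\<^sup>x)\<close>; the shifted series is \<open>(1 - e\<^sup>-\<^sup>x) / x\<close>.
\<close>

definition todd :: "complex fps" where
  "todd = inverse (fps_shift 1 (1 - fps_exp (-1)))"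

text \<open>
  The coefficient of \<open>x\<^bsup>n - 2\<^esup>\<close> in \<open>1 / ((1 - e\<^sup>-\<^sup>x) (1 - e\<^bsup>-t x\<^esup>))\<close>, as the Cauchy product of the Todd
  series at \<open>x\<close> and at \<open>t x\<close>. In this form it is visibly continuous in \<open>t > 0\<close>.
\<close>

definition barnes_coeff :: "real \<Rightarrow> nat \<Rightarrow> complex" where
  "barnes_coeff t n = (\<Sum>i\<le>n. todd $ i * (of_real t ^ (n - i) * todd $ (n - i))) / of_real t"

text \<open>
  The coefficient of \<open>x\<^sup>m\<close> in \<open>(1 - e\<^sup>-\<^sup>x) (1 - e\<^bsup>-t x\<^esup>)\<close>.
\<close>

definition diff_coeff :: "real \<Rightarrow> nat \<Rightarrow> complex" where
  "diff_coeff t m = (0 ^ m - (- 1) ^ m - (- of_real t) ^ m + (- (1 + of_real t)) ^ m) / fact m"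

lemma todd_mult: "todd * (1 - fps_exp (-1)) = fps_X"
proof -
  let ?h = "fps_shift 1 (1 - fps_exp (-1 :: complex))"
  have "?h $ 0 \<noteq> 0" by simp
  hence "todd * ?h = 1" unfolding todd_def by (rule inverse_mult_eq_1)
  hence "todd * (?h * fps_X) = fps_X" by (simp only: mult.assoc [symmetric] mult_1)
  also have "?h * fps_X = 1 - fps_exp (-1)"
    by (rule fps_ext) (simp add: fps_X_mult_right_nth)
  finally show ?thesis .
qed

lemma todd_nth [simp]: "todd $ 0 = 1" "todd $ Suc 0 = 1 / 2"
proof -
  have *: "(todd * (1 - fps_exp (-1))) $ n = fps_X $ n" for n
    by (simp add: todd_mult)
  show 0: "todd $ 0 = 1"
    using *[of 1] by (simp add: fps_mult_nth)
  show "todd $ Suc 0 = 1 / 2"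
    using *[of 2] 0 by (simp add: fps_mult_nth numeral_2_eq_2 fact_reduce)
qed

text \<open>
  The two generating functions are inverse to each other; the index \<open>2\<close> comes from the factor
  \<open>x\<^sup>2\<close> that makes the first one a power series.
\<close>

lemma barnes_coeff_convolution:
  assumes "t > 0"
  shows "(\<Sum>j\<le>n. barnes_coeff t j * diff_coeff t (n - j)) = (if n = 2 then 1 else 0)"
proof -
  define T where "T = complex_of_real t"
  have T: "T \<noteq> 0" using assms by (simp add: T_def)
  let ?l = "fps_const T * fps_X"
  define c where "c = fps_const (1 / T) * (todd * (todd oo ?l))"
  define d where "d = (1 - fps_exp (-1)) * (1 - fps_exp (-T))"
  have c: "c $ n = barnes_coeff t n" for n
    unfolding c_def fps_mult_left_const_nth
    by (simp add: barnes_coeff_def fps_mult_nth fps_compose_linear T_def atMost_atLeast0)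
  have d_eq: "d = 1 - fps_exp (-1) - fps_exp (-T) + fps_exp (-(1 + T))"
    by (simp add: d_def algebra_simps fps_exp_add_mult [symmetric])
  have d: "d $ n = diff_coeff t n" for n
    unfolding d_eq
    by (cases "n = 0") (simp_all add: diff_coeff_def T_def diff_divide_distrib add_divide_distrib)
  have "(todd oo ?l) * (1 - fps_exp (-T)) = (todd * (1 - fps_exp (-1))) oo ?l"
    by (subst fps_compose_mult_distrib) (simp_all add: fps_compose_sub_distrib)
  also have "\<dots> = ?l" by (simp add: todd_mult)
  finally have 1: "(todd oo ?l) * (1 - fps_exp (-T)) = ?l" .
  have "c * d = fps_const (1 / T) * (todd * (1 - fps_exp (-1))) * ((todd oo ?l) * (1 - fps_exp (-T)))"
    by (simp add: c_def d_def mult_ac)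
  also have "\<dots> = fps_const (1 / T) * fps_X * (fps_const T * fps_X)"
    by (simp only: 1 todd_mult)
  also have "\<dots> = (fps_const (1 / T) * fps_const T) * (fps_X * fps_X)" by (simp only: mult_ac)
  also have "\<dots> = fps_X ^ 2" using T by (simp add: power2_eq_square)
  finally have "(c * d) $ n = (fps_X ^ 2 :: complex fps) $ n" by simp
  thus ?thesis by (simp add: fps_mult_nth c d atMost_atLeast0 fps_X_power_nth)
qed

lemma continuous_on_barnes_coeff: "continuous_on {0<..} (\<lambda>t. barnes_coeff t n)"
  unfolding barnes_coeff_def by (intro continuous_intros) auto

section \<open>Asymptotic inversion of the lattice difference\<close>

text \<open>
  This is \<open>\<Gamma>(s + j - 2) / \<Gamma>(s) v\<^bsup>2 - s - j\<^esup>\<close>, the Mellin transform of \<open>x\<^bsup>j - 2\<^esup> e\<^bsup>-v x\<^esup>\<close> divided by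
  \<open>\<Gamma>(s)\<close>. The gamma quotient is written so that it is a polynomial in \<open>s\<close> for \<open>j \<ge> 2\<close>, up to the
  removable points \<open>1\<close> and \<open>2\<close>, and has poles only there for \<open>j < 2\<close>.
\<close>

definition zeta_term :: "nat \<Rightarrow> complex \<Rightarrow> complex \<Rightarrow> complex" where
  "zeta_term j s v = pochhammer (s - 2) j / ((s - 1) * (s - 2)) * v powr (2 - s - of_nat j)"

lemma zeta_term_2: 
  assumes "s \<notin> {1, 2}"
  shows "zeta_term 2 s v = v powr (- s)"
  using assms by (simp add: zeta_term_def numeral_2_eq_2 pochhammer_Suc)

lemma has_field_derivative_zeta_term:
  assumes "Re v > 0"
  shows "(zeta_term j s has_field_derivative - zeta_term (Suc j) s v) (at v)"
proof -
  have "v \<notin> \<real>\<^sub>\<le>\<^sub>0" using assms by (auto simp: complex_nonpos_Reals_iff)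
  hence "(zeta_term j s has_field_derivative pochhammer (s - 2) j / ((s - 1) * (s - 2)) *
          ((2 - s - of_nat j) * v powr (2 - s - of_nat j - 1))) (at v)"
    unfolding zeta_term_def [abs_def]
    by (intro DERIV_cmult has_field_derivative_powr)
  also have "2 - s - of_nat j - 1 = 2 - s - of_nat (Suc j)" by simp
  also have "pochhammer (s - 2) j / ((s - 1) * (s - 2)) *
      ((2 - s - of_nat j) * v powr (2 - s - of_nat (Suc j))) = - zeta_term (Suc j) s v"
  proof -
    have neg: "P / D * (y * W) = - (P * x / D * W)" if "y = - x" for P D x y W :: complex
      using that by simp
    show ?thesis unfolding zeta_term_def pochhammer_Suc by (rule neg) simp
  qed
  finally show ?thesis .
qed

definition lattice_diff :: "real \<Rightarrow> (complex \<Rightarrow> complex) \<Rightarrow> complex \<Rightarrow> complex" where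
  "lattice_diff t f v = f v - f (v + 1) - f (v + of_real t) + f (v + 1 + of_real t)"

text \<open>
  The truncated inverse of the lattice difference, applied to \<open>v\<^sup>-\<^sup>s\<close>; \<open>zeta_rem\<close> measures what it
  misses.
\<close>

definition zeta_main :: "nat \<Rightarrow> complex \<Rightarrow> real \<Rightarrow> complex \<Rightarrow> complex" where
  "zeta_main L s t v = (\<Sum>j\<le>L. barnes_coeff t j * zeta_term j s v)"

definition zeta_rem :: "nat \<Rightarrow> complex \<Rightarrow> real \<Rightarrow> complex \<Rightarrow> complex" where
  "zeta_rem L s t v = v powr (- s) - lattice_diff t (zeta_main L s t) v"

text \<open>
  Taylor expansion along the segment from \<open>v\<close> to \<open>v + a\<close>. Since it points to the right inside the
  right half-plane, neither the real part nor the modulus drops below its value at \<open>v\<close>, so a bound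
  for the next derivative there is controlled by \<open>v\<close> alone, however large \<open>a\<close> is against \<open>\<bar>v\<bar>\<close>.
\<close>

lemma zeta_term_taylor:
  assumes "Re v > 0" "a \<ge> 0" "B \<ge> 0"
    and B: "\<And>u. Re u \<ge> Re v \<Longrightarrow> norm u \<ge> norm v \<Longrightarrow> norm (zeta_term (j + Suc n) s u) \<le> B"
  shows "norm (zeta_term j s (v + of_real a) - 
           (\<Sum>m\<le>n. (- of_real a) ^ m / fact m * zeta_term (j + m) s v)) \<le> B * a ^ Suc n"
proof -
  let ?S = "closed_segment v (v + of_real a)"
  have S: "Re u \<ge> Re v \<and> norm u \<ge> norm v" if u: "u \<in> ?S" for u
  proof -
    obtain x where x: "x \<ge> 0" "u = v + of_real x"
    proof -
      from u obtain y where "0 \<le> y" "u = (1 - y) *\<^sub>R v + y *\<^sub>R (v + of_real a)"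
        by (auto simp: closed_segment_def)
      hence "y * a \<ge> 0" "u = v + of_real (y * a)"
        using assms(2) by (auto simp: scaleR_conv_of_real algebra_simps)
      thus ?thesis by (rule that)
    qed
    hence "Re u \<ge> Re v" "\<bar>Re v\<bar> \<le> \<bar>Re u\<bar>" "\<bar>Im v\<bar> \<le> \<bar>Im u\<bar>" using assms(1) by auto
    thus ?thesis by (auto intro!: real_sqrt_le_mono add_mono simp: cmod_def abs_le_square_iff)
  qed
  define f where "f m u = (-1) ^ m * zeta_term (j + m) s u" for m u
  have "norm (f 0 (v + of_real a) - (\<Sum>m\<le>n. f m v * (v + of_real a - v) ^ m / fact m))
     \<le> B * norm (v + of_real a - v) ^ Suc n / fact n"
  proof (rule complex_Taylor[where S = ?S])
    fix i x assume "x \<in> ?S"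
    hence "Re x > 0" using S assms(1) by force
    hence "(zeta_term (j + i) s has_field_derivative - zeta_term (Suc (j + i)) s x) (at x within ?S)"
      by (rule has_field_derivative_at_within[OF has_field_derivative_zeta_term])
    hence "((\<lambda>v. (-1) ^ i * zeta_term (j + i) s v) has_field_derivative
            (-1) ^ i * - zeta_term (Suc (j + i)) s x) (at x within ?S)"
      by (rule DERIV_cmult)
    thus "(f i has_field_derivative f (Suc i) x) (at x within ?S)"
      by (simp add: f_def [abs_def])
  next
    fix x assume "x \<in> ?S"
    thus "norm (f (Suc n) x) \<le> B"
      using S B[of x] by (simp add: f_def norm_mult norm_power)
  qed auto
  also have "\<dots> \<le> B * a ^ Suc n"
  proof -
    have "B * a ^ Suc n / fact n \<le> B * a ^ Suc n / 1"
      using assms by (intro divide_left_mono) auto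
    thus ?thesis using assms by simp
  qed
  also have "(\<Sum>m\<le>n. f m v * (v + of_real a - v) ^ m / fact m)
     = (\<Sum>m\<le>n. (- of_real a) ^ m / fact m * zeta_term (j + m) s v)"
    by (intro sum.cong refl) (simp add: f_def power_minus')
  finally show ?thesis by (simp add: f_def)
qed

lemma lattice_diff_zeta_term:
  assumes "Re v > 0" "t > 0" "B \<ge> 0"
    and B: "\<And>u. Re u \<ge> Re v \<Longrightarrow> norm u \<ge> norm v \<Longrightarrow> norm (zeta_term (j + Suc n) s u) \<le> B"
  shows "norm (lattice_diff t (zeta_term j s) v - 
           (\<Sum>m\<le>n. diff_coeff t m * zeta_term (j + m) s v)) \<le> 3 * (1 + t) ^ Suc n * B"
proof -
  define S where "S a = (\<Sum>m\<le>n. (- complex_of_real a) ^ m / fact m * zeta_term (j + m) s v)" for a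
  have E: "norm (zeta_term j s (v + of_real a) - S a) \<le> (1 + t) ^ Suc n * B" 
    if "0 \<le> a" "a \<le> 1 + t" for a
  proof -
    have "norm (zeta_term j s (v + of_real a) - S a) \<le> B * a ^ Suc n"
      unfolding S_def using assms that by (intro zeta_term_taylor) auto
    also have "\<dots> \<le> B * (1 + t) ^ Suc n"
      using assms that by (intro mult_left_mono power_mono) auto
    finally show ?thesis by (simp add: mult_ac)
  qed
  have S0: "zeta_term j s v = (\<Sum>m\<le>n. 0 ^ m / fact m * zeta_term (j + m) s v)"
    by (simp add: sum.atMost_shift)
  have "(\<Sum>m\<le>n. diff_coeff t m * zeta_term (j + m) s v) = zeta_term j s v - S 1 - S t + S (1 + t)"
    unfolding S_def 
    by (subst S0) (simp add: sum_subtractf [symmetric] sum.distrib [symmetric] diff_coeff_def 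
      algebra_simps diff_divide_distrib add_divide_distrib)
  hence "lattice_diff t (zeta_term j s) v - (\<Sum>m\<le>n. diff_coeff t m * zeta_term (j + m) s v)
    = (zeta_term j s (v + of_real (1 + t)) - S (1 + t))
      - (zeta_term j s (v + of_real 1) - S 1) - (zeta_term j s (v + of_real t) - S t)"
    by (simp add: lattice_diff_def add_ac)
  also have "norm \<dots> \<le> (1 + t) ^ Suc n * B + (1 + t) ^ Suc n * B + (1 + t) ^ Suc n * B"
    using assms by (intro order_trans[OF norm_triangle_ineq4] add_mono E) auto
  also have "\<dots> = 3 * (1 + t) ^ Suc n * B" by simp
  finally show ?thesis .
qed

definition rem_const :: "nat \<Rightarrow> real \<Rightarrow> real" where
  "rem_const L t = 3 * (1 + t) ^ Suc L * (\<Sum>j\<le>L. norm (barnes_coeff t j))"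

text \<open>
  All \<open>zeta_term j\<close> with \<open>j \<le> L\<close> are expanded up to \<open>zeta_term L\<close>. The Taylor polynomials then add
  up to the convolution of \<open>barnes_coeff\<close> and \<open>diff_coeff\<close>, which leaves \<open>zeta_term 2 = v\<^sup>-\<^sup>s\<close> only,
  and every Taylor error is bounded by the same next term.
\<close>

lemma zeta_rem_bound_aux:
  assumes "Re v > 0" "t > 0" "s \<notin> {1, 2}" "L \<ge> 2" "B \<ge> 0"
    and B: "\<And>u. Re u \<ge> Re v \<Longrightarrow> norm u \<ge> norm v \<Longrightarrow> norm (zeta_term (Suc L) s u) \<le> B"
  shows "norm (zeta_rem L s t v) \<le> rem_const L t * B"
proof -
  have "(\<Sum>j\<le>L. barnes_coeff t j * (\<Sum>m\<le>L - j. diff_coeff t m * zeta_term (j + m) s v))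
    = (\<Sum>(j, m)\<in>(SIGMA j:{..L}. {..L - j}). barnes_coeff t j * diff_coeff t m * zeta_term (j + m) s v)"
    by (subst sum.Sigma [symmetric]) (simp_all add: sum_distrib_left mult_ac)
  also have "(SIGMA j:{..L}. {..L - j}) = {(j, m). j + m \<le> L}" by auto
  also have "(\<Sum>(j, m)\<in>\<dots>. barnes_coeff t j * diff_coeff t m * zeta_term (j + m) s v)
    = (\<Sum>n\<le>L. \<Sum>j\<le>n. barnes_coeff t j * diff_coeff t (n - j) * zeta_term (j + (n - j)) s v)"
    by (rule sum.triangle_reindex_eq)
  also have "\<dots> = (\<Sum>n\<le>L. (\<Sum>j\<le>n. barnes_coeff t j * diff_coeff t (n - j)) * zeta_term n s v)"
    by (simp add: sum_distrib_right)
  also have "\<dots> = (\<Sum>n\<le>L. if n = 2 then zeta_term 2 s v else 0)"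
    by (intro sum.cong) (use assms in \<open>simp_all add: barnes_coeff_convolution\<close>)
  also have "\<dots> = v powr (- s)"
    using assms by (simp add: zeta_term_2)
  finally have 1: "(\<Sum>j\<le>L. barnes_coeff t j * (\<Sum>m\<le>L - j. diff_coeff t m * zeta_term (j + m) s v))
    = v powr (- s)" .
  have 2: "lattice_diff t (zeta_main L s t) v = (\<Sum>j\<le>L. barnes_coeff t j * lattice_diff t (zeta_term j s) v)"
    by (simp add: lattice_diff_def zeta_main_def sum.distrib sum_subtractf algebra_simps)
  have "norm (zeta_rem L s t v) = norm (\<Sum>j\<le>L. barnes_coeff t j * 
    (lattice_diff t (zeta_term j s) v - (\<Sum>m\<le>L - j. diff_coeff t m * zeta_term (j + m) s v)))"
    unfolding zeta_rem_def 2 1 [symmetric] 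
    by (subst norm_minus_commute) (simp add: sum_subtractf algebra_simps)
  also have "\<dots> \<le> (\<Sum>j\<le>L. norm (barnes_coeff t j) * (3 * (1 + t) ^ Suc L * B))"
  proof (rule sum_norm_le, unfold norm_mult, rule mult_left_mono)
    fix j assume j: "j \<in> {..L}"
    have "norm (lattice_diff t (zeta_term j s) v - (\<Sum>m\<le>L - j. diff_coeff t m * zeta_term (j + m) s v))
        \<le> 3 * (1 + t) ^ Suc (L - j) * B"
      using assms j by (intro lattice_diff_zeta_term) auto
    also have "\<dots> \<le> 3 * (1 + t) ^ Suc L * B"
      using assms by (intro mult_right_mono mult_left_mono power_increasing) auto
    finally show "norm (lattice_diff t (zeta_term j s) v - 
        (\<Sum>m\<le>L - j. diff_coeff t m * zeta_term (j + m) s v)) \<le> 3 * (1 + t) ^ Suc L * B" .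
  qed auto
  also have "\<dots> = rem_const L t * B"
    by (simp add: rem_const_def sum_distrib_right sum_distrib_left mult_ac)
  finally show ?thesis .
qed

section \<open>Convergence of the remainder series\<close>

definition lattice_point :: "real \<Rightarrow> complex \<Rightarrow> nat \<times> nat \<Rightarrow> complex" where
  "lattice_point t w k = w + of_nat (fst k) + of_nat (snd k) * of_real t"

lemma Re_lattice_point:
  assumes "Re w > 0" "t > 0"
  shows "Re (lattice_point t w k) > 0"
  using assms by (auto simp: lattice_point_def intro!: add_pos_nonneg)

text \<open>
  Both \<open>1 + k\<^sub>1\<close> and \<open>1 + k\<^sub>2\<close> are at most \<open>1 + k\<^sub>1 + k\<^sub>2\<close>; splitting the exponent evenly between
  them gives a product of two convergent single series.
\<close>

lemma summable_on_lattice_powr: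
  fixes \<rho> :: real
  assumes "\<rho> > 2"
  shows "(\<lambda>k::nat \<times> nat. (1 + real (fst k) + real (snd k)) powr (- \<rho>)) summable_on UNIV"
proof -
  define g where "g n = (1 + real n) powr (- \<rho> / 2)" for n
  have "summable (\<lambda>n. real n powr (- \<rho> / 2))"
    using assms by (subst summable_real_powr_iff) auto
  hence "summable (\<lambda>n. real (Suc n) powr (- \<rho> / 2))" by (subst summable_Suc_iff)
  hence g: "g summable_on UNIV"
    by (subst summable_on_UNIV_nonneg_real_iff) (simp_all add: g_def [abs_def] add_ac)
  have "(\<lambda>k. g (fst k) * g (snd k)) summable_on (SIGMA i:UNIV. UNIV)"
  proof (rule summable_on_SigmaI)
    show "((\<lambda>y. g (fst (x, y)) * g (snd (x, y))) has_sum g x * infsum g UNIV) UNIV" for x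
      using has_sum_cmult_right[OF has_sum_infsum[OF g], of "g x"] by simp
    show "(\<lambda>x. g x * infsum g UNIV) summable_on UNIV"
      by (rule summable_on_cmult_left[OF g])
  qed (auto simp: g_def)
  hence 1: "(\<lambda>k. g (fst k) * g (snd k)) summable_on UNIV" by simp
  show ?thesis
  proof (rule summable_on_comparison_test[OF 1])
    fix k :: "nat \<times> nat"
    let ?x = "1 + real (fst k) + real (snd k)"
    have "?x powr (- \<rho>) = ?x powr (- \<rho> / 2) * ?x powr (- \<rho> / 2)"
      by (simp add: powr_add [symmetric])
    also have "\<dots> \<le> g (fst k) * g (snd k)"
      unfolding g_def using assms by (intro mult_mono powr_mono2') (simp_all add: add_ac)
    finally show "?x powr (- \<rho>) \<le> g (fst k) * g (snd k)" .
  qed auto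
qed

lemma norm_lattice_point_powr:
  assumes "Re w > 0" "t > 0" "\<rho> \<ge> 0"
  shows "norm (lattice_point t w k) powr (- \<rho>) \<le> 
           min 1 (min (Re w) t) powr (- \<rho>) * (1 + real (fst k) + real (snd k)) powr (- \<rho>)"
proof -
  define d where "d = min 1 (min (Re w) t)"
  have d: "0 < d" "d \<le> 1" "d \<le> Re w" "d \<le> t" using assms by (auto simp: d_def)
  have "d * (1 + real (fst k) + real (snd k)) = d + d * real (fst k) + d * real (snd k)"
    by (simp add: algebra_simps)
  also have "\<dots> \<le> Re w + 1 * real (fst k) + t * real (snd k)"
    using d by (intro add_mono mult_right_mono) auto
  also have "\<dots> = Re (lattice_point t w k)" by (simp add: lattice_point_def)
  also have "\<dots> \<le> norm (lattice_point t w k)" by (rule complex_Re_le_cmod)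
  finally have le: "d * (1 + real (fst k) + real (snd k)) \<le> norm (lattice_point t w k)" .
  have "norm (lattice_point t w k) powr (- \<rho>) \<le> (d * (1 + real (fst k) + real (snd k))) powr (- \<rho>)"
    using d assms by (intro powr_mono2' le) auto
  also have "\<dots> = d powr (- \<rho>) * (1 + real (fst k) + real (snd k)) powr (- \<rho>)"
    by (rule powr_mult)
  finally show ?thesis unfolding d_def .
qed

lemma norm_powr_le:
  "norm (v powr a) \<le> exp (pi * \<bar>Im a\<bar>) * norm v powr Re a" for v a :: complex
proof -
  have "- Im a * Arg v \<le> \<bar>- Im a * Arg v\<bar>" by (rule abs_ge_self)
  also have "\<dots> = \<bar>Im a\<bar> * \<bar>Arg v\<bar>" by (simp add: abs_mult)
  also have "\<dots> \<le> \<bar>Im a\<bar> * pi"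
    using Arg_le_pi[of v] mpi_less_Arg[of v] by (intro mult_left_mono) auto
  finally have "exp (- Im a * Arg v) \<le> exp (pi * \<bar>Im a\<bar>)" by (simp add: mult_ac)
  thus ?thesis unfolding norm_powr_complex 
    by (subst mult.commute) (rule mult_right_mono, auto)
qed

definition term_const :: "nat \<Rightarrow> complex \<Rightarrow> real" where
  "term_const j s = norm (pochhammer (s - 2) j / ((s - 1) * (s - 2))) * exp (pi * \<bar>Im s\<bar>)"

lemma norm_zeta_term_le:
  "norm (zeta_term j s v) \<le> term_const j s * norm v powr (2 - Re s - real j)"
proof -
  have "norm (zeta_term j s v) \<le> norm (pochhammer (s - 2) j / ((s - 1) * (s - 2))) * 
    (exp (pi * \<bar>Im (2 - s - of_nat j)\<bar>) * norm v powr Re (2 - s - of_nat j))"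
    unfolding zeta_term_def norm_mult by (intro mult_left_mono norm_powr_le) auto
  thus ?thesis by (simp add: term_const_def mult_ac)
qed

lemma zeta_rem_bound:
  assumes "Re v > 0" "t > 0" "s \<notin> {1, 2}" "L \<ge> 2" "Re s > 1 - real L"
  shows "norm (zeta_rem L s t v) \<le> 
           rem_const L t * term_const (Suc L) s * norm v powr (- (Re s + real L - 1))"
proof -
  have "norm (zeta_rem L s t v) \<le> 
          rem_const L t * (term_const (Suc L) s * norm v powr (2 - Re s - real (Suc L)))"
  proof (rule zeta_rem_bound_aux)
    fix u assume u: "Re u \<ge> Re v" "norm u \<ge> norm v"
    have "norm (zeta_term (Suc L) s u) \<le> term_const (Suc L) s * norm u powr (2 - Re s - real (Suc L))"
      by (rule norm_zeta_term_le)
    also have "\<dots> \<le> term_const (Suc L) s * norm v powr (2 - Re s - real (Suc L))"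
      using assms u by (intro mult_left_mono powr_mono2') (auto simp: term_const_def)
    finally show "norm (zeta_term (Suc L) s u) \<le> \<dots>" .
  qed (use assms in \<open>auto simp: term_const_def\<close>)
  thus ?thesis by (simp add: algebra_simps)
qed

section \<open>Dependence on all three variables\<close>

definition zeta_dom :: "nat \<Rightarrow> (complex \<times> complex \<times> real) set" where
  "zeta_dom L = {(s, w, t). s \<notin> {1, 2} \<and> Re s > 3 - real L \<and> Re w > 0 \<and> t > 0}"

lemma open_zeta_dom: "open (zeta_dom L)"
proof -
  have "zeta_dom L = (({s. Re s > 3 - real L} - {1, 2}) \<times> {w. Re w > 0} \<times> {0<..})"
    by (auto simp: zeta_dom_def)
  also have "open \<dots>"
    by (intro open_Times open_Diff open_halfspace_Re_gt) auto
  finally show ?thesis .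
qed

lemma continuous_on_barnes_coeff' [continuous_intros]:
  assumes "continuous_on S f" "\<And>x. x \<in> S \<Longrightarrow> f x > 0"
  shows "continuous_on S (\<lambda>x. barnes_coeff (f x) n)"
  by (rule continuous_on_compose2[OF continuous_on_barnes_coeff assms(1)]) (use assms(2) in auto)

lemma continuous_on_powr_right_halfplane:
  fixes f g :: "_ \<Rightarrow> complex"
  assumes "continuous_on S f" "continuous_on S g" "\<And>x. x \<in> S \<Longrightarrow> Re (f x) > 0"
  shows "continuous_on S (\<lambda>x. f x powr g x)"
proof (rule continuous_on_powr_complex[OF _ _ assms(1,2)])
  show "S \<subseteq> {z. Re (f z) \<ge> 0 \<or> Im (f z) \<noteq> 0}" using assms(3) by force
  show "Re (g z) > 0" if "z \<in> S" "f z = 0" for z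
    using assms(3)[OF that(1)] that(2) by simp
qed

lemma continuous_on_zeta_term [continuous_intros]:
  assumes "continuous_on S f" "continuous_on S g" 
    "\<And>x. x \<in> S \<Longrightarrow> f x \<notin> {1, 2}" "\<And>x. x \<in> S \<Longrightarrow> Re (g x) > 0"
  shows "continuous_on S (\<lambda>x. zeta_term j (f x) (g x))"
  unfolding zeta_term_def using assms
  by (intro continuous_on_mult continuous_on_powr_right_halfplane continuous_intros) auto

lemma continuous_on_zeta_main [continuous_intros]:
  assumes "continuous_on S f" "continuous_on S g" "continuous_on S h" 
    "\<And>x. x \<in> S \<Longrightarrow> f x \<notin> {1, 2}" "\<And>x. x \<in> S \<Longrightarrow> Re (h x) > 0" "\<And>x. x \<in> S \<Longrightarrow> g x > 0"
  shows "continuous_on S (\<lambda>x. zeta_main L (f x) (g x) (h x))"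
  unfolding zeta_main_def using assms by (intro continuous_intros) auto

lemma continuous_on_zeta_rem [continuous_intros]:
  assumes "continuous_on S f" "continuous_on S g" "continuous_on S h" 
    "\<And>x. x \<in> S \<Longrightarrow> f x \<notin> {1, 2}" "\<And>x. x \<in> S \<Longrightarrow> Re (h x) > 0" "\<And>x. x \<in> S \<Longrightarrow> g x > 0"
  shows "continuous_on S (\<lambda>x. zeta_rem L (f x) (g x) (h x))"
  unfolding zeta_rem_def lattice_diff_def using assms
  by (intro continuous_on_diff continuous_on_powr_right_halfplane continuous_intros) 
     (auto intro!: add_pos_pos)

text \<open>
  A summable majorant that is uniform on compact sets of parameters \<open>(s, w, t)\<close>: the exponent
  \<open>Re s + L - 1\<close> has a minimum greater than \<open>2\<close> on the compact set, and the other factors of the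
  bound are continuous and hence bounded. Holomorphy in \<open>s\<close> and joint continuity both rest on this
  majorant.
\<close>

lemma zeta_rem_majorant:
  assumes "compact K" "K \<subseteq> zeta_dom L" "L \<ge> 2"
  obtains M :: "nat \<times> nat \<Rightarrow> real" where "M summable_on UNIV"
    "\<And>s w t k. (s, w, t) \<in> K \<Longrightarrow> norm (zeta_rem L s t (lattice_point t w k)) \<le> M k"
proof (cases "K = {}")
  case True
  thus ?thesis by (intro that[of "\<lambda>_. 0"]) auto
next
  case False
  have K: "fst p \<notin> {1, 2}" "Re (fst p) > 3 - real L" "Re (fst (snd p)) > 0" "snd (snd p) > 0" 
    if "p \<in> K" for p
    using assms(2) that by (auto simp: zeta_dom_def)
  \<comment> \<open>The part of the bound that depends on the parameters only and not on the lattice point.\<close>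
  define C where "C p = (case p of (s, w, t) \<Rightarrow> rem_const L t * term_const (Suc L) s * 
    min 1 (min (Re w) t) powr (- (Re s + real L - 1)))" for p
  have "continuous_on K (\<lambda>p. rem_const L (snd (snd p)))"
    unfolding rem_const_def by (intro continuous_intros K(4))
  moreover have "continuous_on K (\<lambda>p. term_const (Suc L) (fst p))"
  proof -
    have "(fst p - 1) * (fst p - 2) \<noteq> 0" if "p \<in> K" for p
      using K(1)[OF that] by simp
    thus ?thesis unfolding term_const_def by (intro continuous_intros) blast
  qed
  moreover have "continuous_on K (\<lambda>p. min 1 (min (Re (fst (snd p))) (snd (snd p)))
                   powr (- (Re (fst p) + real L - 1)))"
  proof -
    have "min 1 (min (Re (fst (snd p))) (snd (snd p))) \<noteq> 0" if "p \<in> K" for p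
      using K(3,4)[OF that] by (simp add: min_def)
    thus ?thesis by (intro continuous_intros) blast
  qed
  ultimately have "continuous_on K C"
    unfolding C_def case_prod_unfold by (intro continuous_on_mult)
  from continuous_attains_sup[OF assms(1) False this]
  obtain B where B: "\<And>p. p \<in> K \<Longrightarrow> C p \<le> B" by blast
  have "continuous_on K (\<lambda>p. Re (fst p))" by (intro continuous_intros)
  from continuous_attains_inf[OF assms(1) False this]
  obtain p0 where p0: "p0 \<in> K" "\<And>p. p \<in> K \<Longrightarrow> Re (fst p0) \<le> Re (fst p)" by blast
  define r where "r = Re (fst p0) + real L - 1"
  have r: "r > 2" using K(2)[OF p0(1)] by (simp add: r_def)
  show ?thesis
  proof (rule that)
    show "(\<lambda>k::nat \<times> nat. B * (1 + real (fst k) + real (snd k)) powr (- r)) summable_on UNIV"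
      by (intro summable_on_cmult_right summable_on_lattice_powr r)
    fix s w t and k :: "nat \<times> nat"
    let ?x = "1 + real (fst k) + real (snd k)" and ?r = "Re s + real L - 1"
    assume p: "(s, w, t) \<in> K"
    note Kp = K[OF p, simplified]
    have "norm (zeta_rem L s t (lattice_point t w k)) \<le> 
      rem_const L t * term_const (Suc L) s * norm (lattice_point t w k) powr (- ?r)"
      using Kp assms(3) by (intro zeta_rem_bound Re_lattice_point) auto
    also have "\<dots> \<le> rem_const L t * term_const (Suc L) s * 
      (min 1 (min (Re w) t) powr (- ?r) * ?x powr (- ?r))"
      using Kp by (intro mult_left_mono norm_lattice_point_powr) 
        (auto simp: rem_const_def term_const_def intro!: mult_nonneg_nonneg sum_nonneg divide_nonneg_nonneg)
    also have "\<dots> = C (s, w, t) * ?x powr (- ?r)" by (simp add: C_def)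
    also have "\<dots> \<le> B * ?x powr (- r)"
    proof (rule mult_mono)
      show "?x powr (- ?r) \<le> ?x powr (- r)"
        using p0(2)[OF p] by (intro powr_mono) (auto simp: r_def)
      have "0 \<le> C p0"
        using K[OF p0(1)] by (auto simp: C_def rem_const_def term_const_def case_prod_unfold
          intro!: mult_nonneg_nonneg sum_nonneg)
      thus "0 \<le> B" using B[OF p0(1)] by simp
    qed (use B[OF p] in auto)
    finally show "norm (zeta_rem L s t (lattice_point t w k)) \<le> B * ?x powr (- r)" .
  qed
qed

lemma zeta_rem_summable:
  assumes "(s, w, t) \<in> zeta_dom L" "L \<ge> 2"
  shows "(\<lambda>k. zeta_rem L s t (lattice_point t w k)) summable_on UNIV"
proof -
  obtain M where "M summable_on UNIV" 
    "\<And>k. norm (zeta_rem L s t (lattice_point t w k)) \<le> M k"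
    by (rule zeta_rem_majorant[of "{(s, w, t)}" L]) (use assms in auto)
  hence "(\<lambda>k. norm (zeta_rem L s t (lattice_point t w k))) summable_on UNIV"
    by (rule summable_on_comparison_test) auto
  thus ?thesis by (rule abs_summable_summable)
qed

text \<open>
  The parameters are combined into one triple in order to speak of joint continuity.
\<close>

definition zeta2_cont :: "nat \<Rightarrow> complex \<times> complex \<times> real \<Rightarrow> complex" where
  "zeta2_cont L = (\<lambda>(s, w, t). zeta_main L s t w + (\<Sum>\<^sub>\<infinity>k. zeta_rem L s t (lattice_point t w k)))"

lemma zeta_rem_uniform_limit:
  assumes "compact K" "K \<subseteq> zeta_dom L" "L \<ge> 2"
  shows "uniform_limit K (\<lambda>X p. \<Sum>k\<in>X. zeta_rem L (fst p) (snd (snd p)) (lattice_point (snd (snd p)) (fst (snd p)) k))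
     (\<lambda>p. \<Sum>\<^sub>\<infinity>k. zeta_rem L (fst p) (snd (snd p)) (lattice_point (snd (snd p)) (fst (snd p)) k))
     (finite_subsets_at_top UNIV)"
proof -
  obtain M where "M summable_on UNIV"
    "\<And>s w t k. (s, w, t) \<in> K \<Longrightarrow> norm (zeta_rem L s t (lattice_point t w k)) \<le> M k"
    by (rule zeta_rem_majorant[OF assms]) blast
  thus ?thesis by (intro Weierstrass_m_test_general[where M = M]) auto
qed

lemma continuous_on_zeta2_cont:
  assumes "L \<ge> 2"
  shows "continuous_on (zeta_dom L) (zeta2_cont L)"
proof -
  have "isCont (zeta2_cont L) p" if "p \<in> zeta_dom L" for p
  proof -
    obtain r where r: "r > 0" "cball p r \<subseteq> zeta_dom L"
      using open_zeta_dom \<open>p \<in> zeta_dom L\<close> open_contains_cball by blast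
    have D: "fst x \<notin> {1, 2}" "Re (fst (snd x)) > 0" "snd (snd x) > 0" if "x \<in> cball p r" for x
      using r that by (auto simp: zeta_dom_def)
    have "continuous_on (cball p r) (\<lambda>p. \<Sum>\<^sub>\<infinity>k. zeta_rem L (fst p) (snd (snd p)) (lattice_point (snd (snd p)) (fst (snd p)) k))"
    proof (rule uniform_limit_theorem[OF _ zeta_rem_uniform_limit])
      show "\<forall>\<^sub>F X in finite_subsets_at_top UNIV. continuous_on (cball p r) 
        (\<lambda>p. \<Sum>k\<in>X. zeta_rem L (fst p) (snd (snd p)) (lattice_point (snd (snd p)) (fst (snd p)) k))"
      proof (intro always_eventually allI continuous_on_sum continuous_on_zeta_rem)
        show "continuous_on (cball p r) (\<lambda>p. lattice_point (snd (snd p)) (fst (snd p)) k)" for k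
          unfolding lattice_point_def by (intro continuous_intros)
      qed (use D in \<open>auto intro!: continuous_intros Re_lattice_point\<close>)
    qed (use r assms in auto)
    hence "continuous_on (cball p r) (zeta2_cont L)"
      unfolding zeta2_cont_def case_prod_unfold using D by (intro continuous_intros) auto
    thus ?thesis using r(1)
      by (intro continuous_on_interior[of "cball p r"]) auto
  qed
  thus ?thesis by (intro continuous_at_imp_continuous_on) auto
qed

lemma holomorphic_zeta_term:
  assumes "Re v > 0" "A \<inter> {1, 2} = {}"
  shows "(\<lambda>s. zeta_term j s v) holomorphic_on A"
proof -
  have "v \<noteq> 0" using assms(1) by auto
  thus ?thesis using assms unfolding zeta_term_def by (intro holomorphic_intros) auto
qed

lemma holomorphic_zeta_main:
  assumes "Re v > 0" "A \<inter> {1, 2} = {}"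
  shows "(\<lambda>s. zeta_main L s t v) holomorphic_on A"
  unfolding zeta_main_def using assms by (intro holomorphic_intros holomorphic_zeta_term)

lemma holomorphic_zeta_rem:
  assumes "Re v > 0" "t > 0" "A \<inter> {1, 2} = {}"
  shows "(\<lambda>s. zeta_rem L s t v) holomorphic_on A"
proof -
  have "v \<noteq> 0" using assms(1) by auto
  thus ?thesis using assms unfolding zeta_rem_def lattice_diff_def
    by (intro holomorphic_intros holomorphic_zeta_main) auto
qed

lemma holomorphic_zeta2_cont:
  assumes "L \<ge> 2" "Re w > 0" "t > 0"
  shows "(\<lambda>s. zeta2_cont L (s, w, t)) holomorphic_on ({s. Re s > 3 - real L} - {1, 2})"
    (is "?f holomorphic_on ?A")
proof -
  have A: "open ?A" by (intro open_Diff open_halfspace_Re_gt) auto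
  have "?f field_differentiable at s" if s: "s \<in> ?A" for s
  proof -
    obtain r where r: "r > 0" "cball s r \<subseteq> ?A"
      using A s open_contains_cball by blast
    define R where "R = (\<lambda>s. \<Sum>\<^sub>\<infinity>k. zeta_rem L s t (lattice_point t w k))"
    have "compact ((\<lambda>s. (s, w, t)) ` cball s r)"
      by (intro compact_continuous_image continuous_intros) auto
    moreover have "(\<lambda>s. (s, w, t)) ` cball s r \<subseteq> zeta_dom L"
      using r(2) assms by (auto simp: zeta_dom_def)
    ultimately obtain M where M: "M summable_on UNIV"
      "\<And>s' k. s' \<in> cball s r \<Longrightarrow> norm (zeta_rem L s' t (lattice_point t w k)) \<le> M k"
      by (rule zeta_rem_majorant[OF _ _ assms(1)]) blast
    have "uniform_limit (cball s r) (\<lambda>X s. \<Sum>k\<in>X. zeta_rem L s t (lattice_point t w k)) R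
            (finite_subsets_at_top UNIV)"
      unfolding R_def using M by (intro Weierstrass_m_test_general[where M = M]) auto
    moreover have "(\<lambda>s. \<Sum>k\<in>X. zeta_rem L s t (lattice_point t w k)) holomorphic_on cball s r" for X
      using r(2) assms by (intro holomorphic_intros holomorphic_zeta_rem Re_lattice_point) auto
    ultimately have "R holomorphic_on ball s r"
      by (rule_tac holomorphic_uniform_limit) 
         (auto intro!: always_eventually holomorphic_on_imp_continuous_on 
               intro: holomorphic_on_subset[OF _ ball_subset_cball])
    moreover have "ball s r \<inter> {1, 2} = {}" using r(2) ball_subset_cball[of s r] by blast
    ultimately have "?f holomorphic_on ball s r"
      unfolding zeta2_cont_def R_def prod.case
      using assms by (intro holomorphic_intros holomorphic_zeta_main)
    thus ?thesis using r(1)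
      by (intro holomorphic_on_imp_differentiable_at[OF _ open_ball]) auto
  qed
  thus ?thesis by (auto simp: holomorphic_on_def intro: field_differentiable_at_within)
qed

section \<open>Telescoping\<close>

lemma infsum_diff:
  fixes f g :: "'a \<Rightarrow> complex"
  assumes "f summable_on A" "g summable_on A"
  shows "(\<lambda>x. f x - g x) summable_on A" 
    and "infsum (\<lambda>x. f x - g x) A = infsum f A - infsum g A"
proof -
  have "((\<lambda>x. f x + - g x) has_sum infsum f A + - infsum g A) A"
    using assms by (intro has_sum_add) (auto simp: has_sum_uminus intro: has_sum_infsum)
  thus "(\<lambda>x. f x - g x) summable_on A" "infsum (\<lambda>x. f x - g x) A = infsum f A - infsum g A"
    by (auto simp: has_sum_imp_summable infsumI)
qed

lemma lattice_diff_partial_sum: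
  "(\<Sum>k\<in>{..<n} \<times> {..<n}. lattice_diff t f (lattice_point t w k)) =
     f w - f (w + of_nat n) - f (w + of_nat n * of_real t) + f (w + of_nat n + of_nat n * of_real t)"
proof -
  define D where "D i j = f (w + of_nat i + of_nat j * of_real t)" for i j :: nat
  define H where "H j = D 0 j - D n j" for j
  have "(\<Sum>k\<in>{..<n} \<times> {..<n}. lattice_diff t f (lattice_point t w k)) =
      (\<Sum>j<n. \<Sum>i<n. lattice_diff t f (lattice_point t w (i, j)))"
    by (subst sum.swap) (simp add: sum.cartesian_product)
  also have "\<dots> = (\<Sum>j<n. \<Sum>i<n. (D i j - D (Suc i) j) - (D i (Suc j) - D (Suc i) (Suc j)))"
    by (intro sum.cong refl) (simp add: lattice_diff_def lattice_point_def D_def algebra_simps)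
  also have "\<dots> = (\<Sum>j<n. H j - H (Suc j))"
  proof -
    have "(\<Sum>i<n. D i j - D (Suc i) j) = H j" for j
      unfolding H_def by (rule sum_lessThan_telescope')
    thus ?thesis by (simp only: sum_subtractf [of "\<lambda>i. D i _ - D (Suc i) _"])
  qed
  also have "\<dots> = H 0 - H n"
    by (rule sum_lessThan_telescope')
  finally show ?thesis by (simp add: H_def D_def)
qed

text \<open>
  Over the square \<open>k\<^sub>1, k\<^sub>2 < n\<close> the sum telescopes to the values of \<open>f\<close> at its four corners, of
  which three move to infinity. Given summability, the squares suffice to determine the sum.
\<close>

lemma infsum_lattice_diff:
  assumes "(\<lambda>k. lattice_diff t f (lattice_point t w k)) summable_on UNIV"
    and "(f \<longlongrightarrow> 0) at_infinity" and "t > 0"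
  shows "(\<Sum>\<^sub>\<infinity>k. lattice_diff t f (lattice_point t w k)) = f w"
proof -
  let ?S = "\<lambda>X. \<Sum>k\<in>X. lattice_diff t f (lattice_point t w k)"
  have "filterlim (\<lambda>n. {..<n} \<times> {..<n}) (finite_subsets_at_top (UNIV :: (nat \<times> nat) set)) sequentially"
    unfolding filterlim_finite_subsets_at_top
  proof safe
    fix X :: "(nat \<times> nat) set" assume X: "finite X"
    define N where "N = Max (insert 0 (fst ` X \<union> snd ` X))"
    have N: "fst k \<le> N" "snd k \<le> N" if "k \<in> X" for k
      using X that unfolding N_def by (auto intro!: Max_ge)
    show "\<forall>\<^sub>F n in sequentially. finite ({..<n} \<times> {..<n}) \<and> X \<subseteq> {..<n} \<times> {..<n} \<and> {..<n} \<times> {..<n} \<subseteq> UNIV"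
      using eventually_gt_at_top[of N]
    proof eventually_elim
      case (elim n)
      thus ?case using N by fastforce
    qed
  qed
  moreover have "(?S \<longlongrightarrow> (\<Sum>\<^sub>\<infinity>k. lattice_diff t f (lattice_point t w k))) (finite_subsets_at_top UNIV)"
    using has_sum_infsum[OF assms(1)] by (simp add: has_sum_def)
  ultimately have "(\<lambda>n. ?S ({..<n} \<times> {..<n})) \<longlonglongrightarrow> (\<Sum>\<^sub>\<infinity>k. lattice_diff t f (lattice_point t w k))"
    by (rule filterlim_compose[rotated])
  moreover have "(\<lambda>n. ?S ({..<n} \<times> {..<n})) \<longlonglongrightarrow> f w - 0 - 0 + 0"
  proof -
    have lim: "(\<lambda>n. f (w + of_nat n * of_real c)) \<longlonglongrightarrow> 0" if "c > 0" for c
    proof (rule filterlim_compose[OF assms(2)])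
      have "filterlim (\<lambda>n. real n * c) at_top sequentially"
        using that by (intro filterlim_at_top_mult_tendsto_pos[OF tendsto_const] filterlim_real_sequentially) auto
      hence "filterlim (\<lambda>n. complex_of_real (real n * c)) at_infinity sequentially"
        by (rule filterlim_compose[OF filterlim_of_real_at_infinity])
      thus "filterlim (\<lambda>n. w + of_nat n * of_real c) at_infinity sequentially"
        by (intro tendsto_add_filterlim_at_infinity[OF tendsto_const]) simp
    qed
    show ?thesis
      unfolding lattice_diff_partial_sum
      using lim[of 1] lim[of t] lim[of "1 + t"] assms(3)
      by (intro tendsto_intros) (auto simp: algebra_simps)
  qed
  ultimately show ?thesis by (auto dest: LIMSEQ_unique)
qed

lemma zeta_term_tendsto_0:
  assumes "Re s + real j > 2"
  shows "(zeta_term j s \<longlongrightarrow> 0) at_infinity"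
proof (rule Lim_null_comparison)
  show "\<forall>\<^sub>F v in at_infinity. norm (zeta_term j s v) \<le> term_const j s * norm v powr (2 - Re s - real j)"
    by (simp add: norm_zeta_term_le)
  have "((\<lambda>v::complex. norm v powr (2 - Re s - real j)) \<longlongrightarrow> 0) at_infinity"
    using assms by (intro tendsto_neg_powr filterlim_norm_at_top) auto
  thus "((\<lambda>v::complex. term_const j s * norm v powr (2 - Re s - real j)) \<longlongrightarrow> 0) at_infinity"
    by (rule tendsto_mult_right_zero[of _ at_infinity])
qed

lemma lattice_zeta_summable:
  assumes "Re s > 2" "Re w > 0" "t > 0"
  shows "(\<lambda>k. lattice_point t w k powr (- s)) summable_on UNIV"
proof -
  let ?C = "exp (pi * \<bar>Im s\<bar>) * min 1 (min (Re w) t) powr (- Re s)"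
  have "(\<lambda>k. norm (lattice_point t w k powr (- s))) summable_on UNIV"
  proof (rule summable_on_comparison_test)
    show "(\<lambda>k::nat \<times> nat. ?C * (1 + real (fst k) + real (snd k)) powr (- Re s)) summable_on UNIV"
      using assms by (intro summable_on_cmult_right summable_on_lattice_powr)
    fix k :: "nat \<times> nat"
    have "norm (lattice_point t w k powr (- s)) \<le> 
            exp (pi * \<bar>Im (-s)\<bar>) * norm (lattice_point t w k) powr Re (-s)"
      by (rule norm_powr_le)
    also have "\<dots> = exp (pi * \<bar>Im s\<bar>) * norm (lattice_point t w k) powr (- Re s)" by simp
    also have "\<dots> \<le> exp (pi * \<bar>Im s\<bar>) * (min 1 (min (Re w) t) powr (- Re s) * 
                    (1 + real (fst k) + real (snd k)) powr (- Re s))"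
      using assms by (intro mult_left_mono norm_lattice_point_powr) auto
    finally show "norm (lattice_point t w k powr (- s)) \<le> ?C * (1 + real (fst k) + real (snd k)) powr (- Re s)"
      by (simp add: mult_ac)
  qed auto
  thus ?thesis by (rule abs_summable_summable)
qed

text \<open>
  For \<open>Re s > 2\<close> even \<open>zeta_term 0\<close> vanishes at infinity, so the lattice sum of
  \<open>lattice_diff (zeta_main L)\<close> telescopes to \<open>zeta_main L w\<close>.
\<close>

lemma zeta2_cont_eq_series:
  assumes "Re s > 2" "Re w > 0" "t > 0" "L \<ge> 2"
  shows "zeta2_cont L (s, w, t) = (\<Sum>\<^sub>\<infinity>k. lattice_point t w k powr (- s))"
proof -
  have "(s, w, t) \<in> zeta_dom L" using assms by (auto simp: zeta_dom_def)
  note summ = zeta_rem_summable[OF this assms(4)] lattice_zeta_summable[OF assms(1-3)]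
  have diff: "lattice_diff t (zeta_main L s t) v = v powr (- s) - zeta_rem L s t v" for v
    by (simp add: zeta_rem_def)
  have "(\<Sum>\<^sub>\<infinity>k. lattice_diff t (zeta_main L s t) (lattice_point t w k)) = zeta_main L s t w"
  proof (rule infsum_lattice_diff)
    show "(\<lambda>k. lattice_diff t (zeta_main L s t) (lattice_point t w k)) summable_on UNIV"
      unfolding diff by (rule infsum_diff(1)[OF summ(2,1)])
    show "(zeta_main L s t \<longlongrightarrow> 0) at_infinity"
      unfolding zeta_main_def [abs_def] using assms(1)
      by (intro tendsto_null_sum tendsto_mult_right_zero zeta_term_tendsto_0) auto
  qed fact
  thus ?thesis
    unfolding zeta2_cont_def diff using infsum_diff(2)[OF summ(2,1)] by (simp add: algebra_simps)
qed

text \<open>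
  One more term changes the remainder by a lattice difference of \<open>zeta_term (L + 1)\<close>, which vanishes
  at infinity already for \<open>Re s > 1 - L\<close>; its lattice sum is the new term of \<open>zeta_main\<close>.
\<close>

lemma zeta2_cont_Suc:
  assumes "(s, w, t) \<in> zeta_dom L" "L \<ge> 2"
  shows "zeta2_cont (Suc L) (s, w, t) = zeta2_cont L (s, w, t)"
proof -
  have "(s, w, t) \<in> zeta_dom (Suc L)" using assms(1) by (auto simp: zeta_dom_def)
  note summ = zeta_rem_summable[OF assms] zeta_rem_summable[OF this le_SucI[OF assms(2)]]
  let ?f = "\<lambda>v. barnes_coeff t (Suc L) * zeta_term (Suc L) s v"
  have diff: "lattice_diff t ?f v = zeta_rem L s t v - zeta_rem (Suc L) s t v" for v
    by (simp add: zeta_rem_def lattice_diff_def zeta_main_def)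
  have "(\<Sum>\<^sub>\<infinity>k. lattice_diff t ?f (lattice_point t w k)) = ?f w"
  proof (rule infsum_lattice_diff)
    show "(\<lambda>k. lattice_diff t ?f (lattice_point t w k)) summable_on UNIV"
      unfolding diff by (rule infsum_diff(1)[OF summ])
    show "(?f \<longlongrightarrow> 0) at_infinity"
      using assms by (intro tendsto_mult_right_zero zeta_term_tendsto_0) (auto simp: zeta_dom_def)
  qed (use assms in \<open>auto simp: zeta_dom_def\<close>)
  hence "(\<Sum>\<^sub>\<infinity>k. zeta_rem L s t (lattice_point t w k)) - (\<Sum>\<^sub>\<infinity>k. zeta_rem (Suc L) s t (lattice_point t w k)) 
    = ?f w"
    unfolding diff using infsum_diff(2)[OF summ] by simp
  thus ?thesis by (simp add: zeta2_cont_def zeta_main_def algebra_simps)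
qed

lemma zeta2_cont_cong:
  assumes "(s, w, t) \<in> zeta_dom L" "L \<ge> 2" "L \<le> L'"
  shows "zeta2_cont L' (s, w, t) = zeta2_cont L (s, w, t)"
  using assms(3)
proof (induction rule: dec_induct)
  case (step n)
  have "(s, w, t) \<in> zeta_dom n" using assms(1) step.hyps by (auto simp: zeta_dom_def)
  thus ?case using zeta2_cont_Suc[of s w t n] step assms(2) by simp
qed auto

section \<open>The continuation of the Barnes zeta function\<close>

lemma connected_Re_gt_minus_12: "connected ({s. Re s > c} - {1, 2})"
  by (intro connected_open_delete_finite open_halfspace_Re_gt convex_connected convex_halfspace_Re_gt) auto

text \<open>
  Existence of the continuation, so that the choice in the definition of \<open>barnes_zeta2\<close> is not
  void. Near each \<open>s\<close> some \<open>zeta2_cont L\<close> works, and any two of them agree where both converge.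
\<close>

lemma barnes_zeta2_continuation:
  assumes w: "Re w > 0" and t: "t > 0"
  shows holomorphic_barnes_zeta2: "barnes_zeta2 t w holomorphic_on (- {1, 2})"
    and barnes_zeta2_series: "Re s > 2 \<Longrightarrow> barnes_zeta2 t w s = (\<Sum>\<^sub>\<infinity>k. lattice_point t w k powr (- s))"
proof -
  \<comment> \<open>An order that works at \<open>s\<close>, since \<open>Re s \<ge> - norm s\<close>.\<close>
  define L where "L s = nat \<lceil>norm s\<rceil> + 4" for s :: complex
  define Z where "Z s = zeta2_cont (L s) (s, w, t)" for s
  have dom: "(s, w, t) \<in> zeta_dom (L s)" if "s \<notin> {1, 2}" for s
  proof -
    have "- norm s \<le> Re s" using abs_Re_le_cmod[of s] by linarith
    moreover have "norm s \<le> real (nat \<lceil>norm s\<rceil>)" by (rule real_nat_ceiling_ge)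
    moreover have "real (L s) = real (nat \<lceil>norm s\<rceil>) + 4" by (simp add: L_def)
    ultimately have "Re s > 3 - real (L s)" by linarith
    thus ?thesis using w t that by (simp add: zeta_dom_def)
  qed
  have L2: "L s \<ge> 2" for s by (simp add: L_def)
  have Z_eq: "Z s = zeta2_cont L' (s, w, t)" if "(s, w, t) \<in> zeta_dom L'" "L' \<ge> 2" for s L'
  proof -
    have "(s, w, t) \<in> zeta_dom (L s)" using that by (intro dom) (auto simp: zeta_dom_def)
    thus ?thesis
      using zeta2_cont_cong[of s w t "L s" "max (L s) L'"] zeta2_cont_cong[of s w t L' "max (L s) L'"] 
            that L2[of s] by (simp add: Z_def)
  qed
  have "Z field_differentiable at s" if s: "s \<notin> {1, 2}" for s
  proof -
    let ?A = "{u. Re u > 3 - real (L s)} - {1, 2}"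
    have "(\<lambda>u. zeta2_cont (L s) (u, w, t)) holomorphic_on ?A"
      by (rule holomorphic_zeta2_cont) (use L2 w t in auto)
    also have "?this \<longleftrightarrow> Z holomorphic_on ?A"
      by (intro holomorphic_cong refl Z_eq [symmetric]) (use L2 w t in \<open>auto simp: zeta_dom_def\<close>)
    finally show ?thesis
      by (rule holomorphic_on_imp_differentiable_at)
         (use dom[OF s] s in \<open>auto intro!: open_Diff open_halfspace_Re_gt simp: zeta_dom_def\<close>)
  qed
  hence "Z holomorphic_on (- {1, 2})"
    by (auto simp: holomorphic_on_def intro: field_differentiable_at_within)
  moreover have "Z s = (\<Sum>\<^sub>\<infinity>(k1, k2)\<in>(UNIV :: (nat \<times> nat) set).
                 (w + of_nat k1 + of_nat k2 * of_real t) powr (- s))" if s: "Re s > 2" for s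
    using zeta2_cont_eq_series[OF s w t L2] dom[of s] s
    by (auto simp: Z_def lattice_point_def case_prod_unfold)
  ultimately have "barnes_zeta2 t w holomorphic_on (- {1, 2}) \<and> (\<forall>s. Re s > 2 \<longrightarrow> 
     barnes_zeta2 t w s = (\<Sum>\<^sub>\<infinity>(k1, k2)\<in>(UNIV :: (nat \<times> nat) set).
                 (w + of_nat k1 + of_nat k2 * of_real t) powr (- s)))"
    unfolding barnes_zeta2_def by - (rule someI[where x = Z], blast)
  thus "barnes_zeta2 t w holomorphic_on (- {1, 2})" 
    "Re s > 2 \<Longrightarrow> barnes_zeta2 t w s = (\<Sum>\<^sub>\<infinity>k. lattice_point t w k powr (- s))"
    by (auto simp: lattice_point_def case_prod_unfold)
qed

lemma barnes_zeta2_eq_zeta2_cont: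
  assumes "(s, w, t) \<in> zeta_dom L" "L \<ge> 2"
  shows "barnes_zeta2 t w s = zeta2_cont L (s, w, t)"
proof -
  have wt: "Re w > 0" "t > 0" using assms by (auto simp: zeta_dom_def)
  let ?A = "{u. Re u > 3 - real L} - {1, 2}" and ?U = "{u. Re u > 2}"
  show ?thesis
  proof (rule analytic_continuation_open[where f = "barnes_zeta2 t w" and s = ?U and s' = ?A])
    have "Re (of_nat 3) > 2" by simp
    thus "?U \<noteq> {}" by blast
    show "?U \<subseteq> ?A" using assms(2) by auto
    show "barnes_zeta2 t w holomorphic_on ?A"
      by (rule holomorphic_on_subset[OF holomorphic_barnes_zeta2[OF wt]]) auto
    show "barnes_zeta2 t w u = zeta2_cont L (u, w, t)" if "u \<in> ?U" for u
      using that wt assms(2) by (simp add: barnes_zeta2_series zeta2_cont_eq_series)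
    show "(\<lambda>u. zeta2_cont L (u, w, t)) holomorphic_on ?A"
      by (intro holomorphic_zeta2_cont assms wt)
  qed (use assms in \<open>auto simp: zeta_dom_def connected_Re_gt_minus_12 
         intro!: open_Diff open_halfspace_Re_gt\<close>)
qed

section \<open>Value at zero, scaling and continuity\<close>

text \<open>
  At \<open>s = 0\<close> the factor \<open>pochhammer (-2) j\<close> vanishes for \<open>j \<ge> 3\<close>. In particular the bound for the
  remainder is \<open>0\<close>.
\<close>

lemma barnes_zeta2_at_0:
  assumes "Re w > 0" "t > 0"
  shows "barnes_zeta2 t w 0 = (w ^ 2 - (1 + of_real t) * w) / (2 * of_real t) + barnes_coeff t 2"
proof -
  have van: "zeta_term j 0 v = 0" if "j \<ge> 3" for j v
  proof -
    have "pochhammer (- 2 :: complex) j = 0"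
      using pochhammer_of_nat_eq_0_lemma[of 2 j] that by simp
    thus ?thesis by (simp add: zeta_term_def)
  qed
  \<comment> \<open>The order \<open>4\<close> is the least \<open>L\<close> for which \<open>0\<close> lies in the half-plane \<open>Re s > 3 - L\<close>.\<close>
  have "norm (zeta_rem 4 0 t (lattice_point t w k)) \<le> rem_const 4 t * 0" for k
    using assms by (intro zeta_rem_bound_aux Re_lattice_point) (auto simp: van)
  hence rem: "zeta_rem 4 0 t (lattice_point t w k) = 0" for k by simp
  have "(0, w, t) \<in> zeta_dom 4" using assms by (simp add: zeta_dom_def)
  hence "barnes_zeta2 t w 0 = zeta_main 4 0 t w"
    by (subst barnes_zeta2_eq_zeta2_cont[of _ _ _ 4]) (auto simp: zeta2_cont_def rem)
  also have "\<dots> = (\<Sum>j\<in>{0, 1, 2}. barnes_coeff t j * zeta_term j 0 w)"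
    unfolding zeta_main_def
    by (rule sum.mono_neutral_right) (auto simp: van)
  also have "\<dots> = barnes_coeff t 0 * (w ^ 2 / 2) - barnes_coeff t 1 * w + barnes_coeff t 2"
    using assms(1) by (auto simp: zeta_term_def numeral_2_eq_2 pochhammer_Suc powr_nat')
  also have "\<dots> = (w ^ 2 - (1 + of_real t) * w) / (2 * of_real t) + barnes_coeff t 2"
    using assms(2) by (simp add: barnes_coeff_def field_simps)
  finally show ?thesis .
qed

lemma barnes_zeta2_scaling:
  assumes wt: "Re w > 0" "t > 0" and s: "s \<notin> {1, 2}"
  shows "barnes_zeta2 (1 / t) (w / of_real t) s = of_real t powr s * barnes_zeta2 t w s"
proof (rule analytic_continuation_open[where s = "{u. Re u > 2}" and s' = "- {1, 2}" and z = s and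
    f = "barnes_zeta2 (1 / t) (w / of_real t)" and g = "\<lambda>s. of_real t powr s * barnes_zeta2 t w s"])
  have "Re (of_nat 3) > 2" by simp
  thus "{u. Re u > 2} \<noteq> {}" by blast
  have "UNIV - {1, 2} = - {1, 2 :: complex}" by auto
  thus "connected (- {1, 2 :: complex})"
    using connected_open_delete_finite[of "UNIV :: complex set" "{1, 2}"] 
    by (simp add: convex_connected)
  show "barnes_zeta2 (1 / t) (w / of_real t) holomorphic_on (- {1, 2})"
    using wt by (intro holomorphic_barnes_zeta2) auto
  show "(\<lambda>s. of_real t powr s * barnes_zeta2 t w s) holomorphic_on (- {1, 2})"
    using wt by (intro holomorphic_intros holomorphic_barnes_zeta2) auto
next
  fix u assume "u \<in> {u. Re u > 2}"
  hence u: "Re u > 2" by simp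
  have "barnes_zeta2 (1 / t) (w / of_real t) u = 
      (\<Sum>\<^sub>\<infinity>k. lattice_point (1 / t) (w / of_real t) k powr (- u))"
    using wt u by (intro barnes_zeta2_series) auto
  also have "\<dots> = (\<Sum>\<^sub>\<infinity>k. lattice_point (1 / t) (w / of_real t) (prod.swap k) powr (- u))"
    by (rule infsum_reindex_bij_betw [symmetric]) (rule bij_swap)
  also have "\<dots> = (\<Sum>\<^sub>\<infinity>k. of_real t powr u * lattice_point t w k powr (- u))"
  proof (rule infsum_cong)
    fix k
    let ?v = "lattice_point t w k"
    have 1: "lattice_point (1 / t) (w / of_real t) (prod.swap k) = ?v / of_real t"
      using wt by (simp add: lattice_point_def field_simps)
    have 2: "?v \<noteq> 0"
      using Re_lattice_point[OF wt, of k] by auto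
    hence 3: "Ln (?v / of_real t) = Ln ?v - of_real (ln t)"
      using wt by (intro Ln_divide_of_real) auto
    have "(?v / of_real t) powr (- u) = exp (- u * (Ln ?v - of_real (ln t)))"
      using 2 3 wt by (simp add: powr_def)
    also have "\<dots> = exp (u * of_real (ln t)) * exp (- u * Ln ?v)"
      by (simp add: exp_add [symmetric] algebra_simps)
    also have "\<dots> = of_real t powr u * ?v powr (- u)"
      using 2 wt by (simp add: powr_def Ln_of_real)
    finally show "lattice_point (1 / t) (w / of_real t) (prod.swap k) powr (- u) = 
        of_real t powr u * ?v powr (- u)"
      by (simp only: 1)
  qed
  also have "\<dots> = of_real t powr u * barnes_zeta2 t w u"
    using wt u by (simp add: barnes_zeta2_series infsum_cmult_right')
  finally show "barnes_zeta2 (1 / t) (w / of_real t) u = of_real t powr u * barnes_zeta2 t w u" .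
qed (use s in \<open>auto intro: open_halfspace_Re_gt\<close>)

lemma deriv_barnes_zeta2_scaling:
  assumes wt: "Re w > 0" "t > 0"
  shows "deriv (barnes_zeta2 (1 / t) (w / of_real t)) 0 = 
           of_real (ln t) * barnes_zeta2 t w 0 + deriv (barnes_zeta2 t w) 0"
proof -
  have "(barnes_zeta2 t w has_field_derivative deriv (barnes_zeta2 t w) 0) (at 0)"
    by (rule holomorphic_derivI[OF holomorphic_barnes_zeta2[OF wt]]) auto
  hence "((\<lambda>s. of_real t powr s * barnes_zeta2 t w s) has_field_derivative
          of_real (ln t) * barnes_zeta2 t w 0 + deriv (barnes_zeta2 t w) 0) (at 0)"
    using wt by (auto intro!: derivative_eq_intros simp: Ln_of_real)
  also have "?this \<longleftrightarrow> (barnes_zeta2 (1 / t) (w / of_real t) has_field_derivative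
          of_real (ln t) * barnes_zeta2 t w 0 + deriv (barnes_zeta2 t w) 0) (at 0)"
  proof (rule DERIV_cong_ev)
    have "eventually (\<lambda>s. s \<in> - {1, 2 :: complex}) (nhds 0)"
      by (intro eventually_nhds_in_open) auto
    thus "\<forall>\<^sub>F s in nhds 0. of_real t powr s * barnes_zeta2 t w s = 
            barnes_zeta2 (1 / t) (w / of_real t) s"
      by eventually_elim (use wt in \<open>simp add: barnes_zeta2_scaling\<close>)
  qed auto
  finally show ?thesis by (rule DERIV_imp_deriv)
qed

text \<open>
  On a fixed disc around \<open>0\<close> the functions \<open>s \<mapsto> \<zeta>\<^sub>2(s, w | t)\<close> depend on \<open>(w, t)\<close> continuously with
  respect to uniform convergence, because \<open>zeta2_cont\<close> is uniformly continuous on compact sets.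
  By Cauchy's formula the same holds for their derivatives at \<open>0\<close>.
\<close>

lemma continuous_deriv_barnes_zeta2:
  assumes "Re w > 0" "t > 0"
  shows "isCont (\<lambda>p. deriv (barnes_zeta2 (snd p) (fst p)) 0) (w, t)"
proof -
  define p0 where "p0 = (w, t)"
  let ?B = "ball (0 :: complex) (1 / 2)"
  have "open ({w. Re w > 0} \<times> {0<..} :: (complex \<times> real) set)"
    by (rule open_Times[OF open_halfspace_Re_gt open_greaterThan])
  moreover have "p0 \<in> {w. Re w > 0} \<times> {0<..}" using assms by (simp add: p0_def)
  ultimately obtain r where r: "r > 0" "cball p0 r \<subseteq> {w. Re w > 0} \<times> {0<..}"
    using open_contains_cball by metis
  have dom: "(s, p) \<in> zeta_dom 4" if "s \<in> cball 0 (1 / 2)" "p \<in> cball p0 r" for s p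
  proof -
    have "\<bar>Re s\<bar> \<le> 1 / 2" using that(1) abs_Re_le_cmod[of s] by simp
    hence "s \<noteq> 1" "s \<noteq> 2" "Re s > 3 - real 4" by auto
    thus ?thesis using r(2) that(2) by (cases p) (auto simp: zeta_dom_def)
  qed
  define K where "K = cball (0 :: complex) (1 / 2) \<times> cball p0 r"
  have "continuous_on K (zeta2_cont 4)"
    by (rule continuous_on_subset[OF continuous_on_zeta2_cont]) (use dom in \<open>auto simp: K_def\<close>)
  moreover have "compact K" unfolding K_def by (intro compact_Times) auto
  ultimately have "uniformly_continuous_on K (zeta2_cont 4)"
    by (rule compact_uniformly_continuous)
  have ev: "\<forall>\<^sub>F p in at p0. p \<in> cball p0 r"
    using r(1) by (intro eventually_at_in_open'[THEN eventually_mono, of "ball p0 r"]) auto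
  have eq: "barnes_zeta2 (snd p) (fst p) s = zeta2_cont 4 (s, p)" 
    if "s \<in> ?B" "p \<in> cball p0 r" for s p
    using barnes_zeta2_eq_zeta2_cont[of s "fst p" "snd p" 4] dom[of s p] that by simp
  have "uniform_limit ?B (\<lambda>p. barnes_zeta2 (snd p) (fst p)) (barnes_zeta2 (snd p0) (fst p0)) (at p0)"
  proof (rule uniform_limitI)
    fix e :: real assume "e > 0"
    then obtain d where d: "d > 0" 
      "\<And>x y. x \<in> K \<Longrightarrow> y \<in> K \<Longrightarrow> dist x y < d \<Longrightarrow> dist (zeta2_cont 4 x) (zeta2_cont 4 y) < e"
      using \<open>uniformly_continuous_on K (zeta2_cont 4)\<close> unfolding uniformly_continuous_on_def by metis
    have "\<forall>\<^sub>F p in at p0. dist p p0 < d"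
      using d(1) by (auto simp: eventually_at)
    with ev show "\<forall>\<^sub>F p in at p0. \<forall>s\<in>?B. 
      dist (barnes_zeta2 (snd p) (fst p) s) (barnes_zeta2 (snd p0) (fst p0) s) < e"
    proof eventually_elim
      case (elim p)
      show ?case
      proof
        fix s assume s: "s \<in> ?B"
        have "dist (zeta2_cont 4 (s, p)) (zeta2_cont 4 (s, p0)) < e"
          using elim s r(1) by (intro d(2)) (auto simp: K_def dist_Pair_Pair)
        thus "dist (barnes_zeta2 (snd p) (fst p) s) (barnes_zeta2 (snd p0) (fst p0) s) < e"
          using elim s r(1) by (simp add: eq)
      qed
    qed
  qed
  moreover have "\<forall>\<^sub>F p in at p0. barnes_zeta2 (snd p) (fst p) holomorphic_on ?B"
    using ev
  proof eventually_elim
    case (elim p)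
    have "?B \<subseteq> - {1, 2}" by auto
    thus ?case using elim r(2)
      by (intro holomorphic_on_subset[OF holomorphic_barnes_zeta2]) auto
  qed
  ultimately have "((\<lambda>p. (deriv ^^ 1) (barnes_zeta2 (snd p) (fst p)) 0) \<longlongrightarrow> 
      (deriv ^^ 1) (barnes_zeta2 (snd p0) (fst p0)) 0) (at p0)"
    by (rule higher_deriv_complex_uniform_limit) auto
  thus ?thesis by (simp add: isCont_def p0_def)
qed

lemma barnes_Gamma2_nonzero:
  assumes "Re w > 0"
  shows "barnes_Gamma2 t w \<noteq> 0"
  using assms by (simp add: barnes_Gamma2_def barnes_Gamma2_right_def)

lemma barnes_Gamma2_scaling:
  assumes "Re w > 0" "t > 0"
  shows "barnes_Gamma2 (1 / t) (w / of_real t) = 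
           exp (of_real (ln t) * barnes_zeta2 t w 0) * barnes_Gamma2 t w"
  using assms by (simp add: barnes_Gamma2_def barnes_Gamma2_right_def deriv_barnes_zeta2_scaling exp_add)

lemma tendsto_barnes_Gamma2:
  assumes f: "(f \<longlongrightarrow> w) F" and g: "(g \<longlongrightarrow> t) F" and wt: "Re w > 0" "t > 0"
  shows "((\<lambda>x. barnes_Gamma2 (g x) (f x)) \<longlongrightarrow> barnes_Gamma2 t w) F"
proof -
  have "((\<lambda>x. exp (deriv (barnes_zeta2 (snd (f x, g x)) (fst (f x, g x))) 0)) \<longlongrightarrow> 
          exp (deriv (barnes_zeta2 (snd (w, t)) (fst (w, t))) 0)) F"
    by (intro tendsto_exp isCont_tendsto_compose[OF continuous_deriv_barnes_zeta2[OF wt]] 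
          tendsto_Pair f g)
  hence "((\<lambda>x. barnes_Gamma2_right (g x) (f x)) \<longlongrightarrow> barnes_Gamma2_right t w) F"
    by (simp add: barnes_Gamma2_right_def)
  moreover have "\<forall>\<^sub>F x in F. Re (f x) > 0"
    using order_tendstoD(1)[OF tendsto_Re[OF f] wt(1)] .
  hence "\<forall>\<^sub>F x in F. barnes_Gamma2_right (g x) (f x) = barnes_Gamma2 (g x) (f x)"
    by eventually_elim (simp add: barnes_Gamma2_def)
  ultimately have "((\<lambda>x. barnes_Gamma2 (g x) (f x)) \<longlongrightarrow> barnes_Gamma2_right t w) F"
    by (rule Lim_transform_eventually)
  thus ?thesis using wt by (simp add: barnes_Gamma2_def)
qed

text \<open>
  In a quotient the constant term of \<open>\<zeta>\<^sub>2(0, w)\<close> cancels.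
\<close>

lemma barnes_Gamma2_ratio_scaling:
  assumes "Re a > 0" "Re b > 0" "t > 0"
  shows "barnes_Gamma2 (1 / t) (a / of_real t) / barnes_Gamma2 (1 / t) (b / of_real t) =
    exp (of_real (ln t) * ((a ^ 2 - b ^ 2 - (1 + of_real t) * (a - b)) / (2 * of_real t))) 
    * (barnes_Gamma2 t a / barnes_Gamma2 t b)"
proof -
  have "(a ^ 2 - b ^ 2 - (1 + of_real t) * (a - b)) / (2 * of_real t) = 
          barnes_zeta2 t a 0 - barnes_zeta2 t b 0"
    using assms by (simp add: barnes_zeta2_at_0 add_divide_distrib diff_divide_distrib
      distrib_left distrib_right right_diff_distrib left_diff_distrib)
  thus ?thesis
    using assms by (simp add: barnes_Gamma2_scaling right_diff_distrib exp_diff)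
qed

section \<open>The involution\<close>

text \<open>
  A region in which all arguments of \<open>\<Gamma>\<^sub>2\<close> have positive real part. The conditions are linear in
  \<open>t\<close>, \<open>t * l1\<close>, \<open>t * l2\<close> and \<open>Re q\<close>, and they are open in \<open>t\<close>, so they persist near \<open>\<tau>\<close>.
\<close>

definition CM_strip :: "complex \<Rightarrow> real \<Rightarrow> real \<Rightarrow> real \<Rightarrow> bool" where
  "CM_strip q t l1 l2 \<longleftrightarrow> t > 0 \<and> t * l1 < 0 \<and> t * l2 < 0 \<and>
     1 + t + t * l1 > 0 \<and> 1 + t + t * l2 > 0 \<and>
     1 + t + t * l1 + t * l2 < Re q \<and> 1 + t + t * l1 + t * l2 < 2 * Re q \<and> 
     Re q < t \<and> Re q < 1 + t + t * l1 \<and> Re q < 1 + t + t * l2"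

text \<open>
  Each quotient of double gamma functions contributes \<open>t\<close> to the power \<open>Q a b\<close>, the difference of
  the quadratic polynomials at \<open>a\<close> and \<open>b\<close>. In the sum of the eight differences the terms in \<open>q\<^sup>2\<close>
  and all terms in \<open>l1\<close>, \<open>l2\<close> cancel, and \<open>q (1 + t) / t\<close> remains.
\<close>

lemma CM_factors_scaling:
  assumes strip: "CM_strip q t l1 l2"
  shows "CM_factors (q / of_real t) (1 / t) (t * l1) (t * l2) * Gamma (1 - q / of_real t) =
           exp (of_real (ln t) * (q * (1 + of_real t) / of_real t)) * 
           CM_factors q t l1 l2 * Gamma (1 - q)"
proof -
  define T where "T = complex_of_real t"
  define m1 m2 where "m1 = complex_of_real l1" and "m2 = complex_of_real l2"
  have t: "t > 0" and T: "T \<noteq> 0" using strip by (auto simp: CM_strip_def T_def)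
  define Q where "Q a b = (a ^ 2 - b ^ 2 - (1 + T) * (a - b)) / (2 * T)" for a b :: complex
  define E where "E a b = exp (of_real (ln t) * Q a b)" for a b
  define r where "r a b = barnes_Gamma2 t a / barnes_Gamma2 t b" for a b
  define r' where "r' a b = barnes_Gamma2 (1 / t) (a / T) / barnes_Gamma2 (1 / t) (b / T)" for a b
  have r': "r' a b = E a b * r a b" if "Re a > 0" "Re b > 0" for a b
    unfolding r'_def r_def E_def Q_def T_def
    using that t by (rule barnes_Gamma2_ratio_scaling)
  have args:
    "1 - q / T + 1 / T * (1 + T * m1) = (1 - q + T * (1 + m1)) / T" 
    "1 + 1 / T * (1 + T * m1) = (1 + T * (1 + m1)) / T" 
    "1 - q / T + 1 / T * (1 + T * m2) = (1 - q + T * (1 + m2)) / T" 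
    "1 + 1 / T * (1 + T * m2) = (1 + T * (1 + m2)) / T" 
    "1 - q / T + 1 / T = (1 - q + T) / T" "1 + 1 / T = (1 + T) / T"
    "2 - q / T + 1 / T * (2 + T * m1 + T * m2) = (2 - q + T * (2 + m1 + m2)) / T"
    "2 - 2 * (q / T) + 1 / T * (2 + T * m1 + T * m2) = (2 - 2 * q + T * (2 + m1 + m2)) / T"
    "q / T + 1 + 1 / T = (q + 1 + T) / T"
    "q / T - 1 / T * (T * m1) = (q - T * m1) / T" "- (1 / T * (T * m1)) = - (T * m1) / T"
    "q / T - 1 / T * (T * m2) = (q - T * m2) / T" "- (1 / T * (T * m2)) = - (T * m2) / T"
    "q / T - 1 - 1 / T * (1 + T * m1 + T * m2) = (q - 1 - T * (1 + m1 + m2)) / T"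
    "2 * (q / T) - 1 - 1 / T * (1 + T * m1 + T * m2) = (2 * q - 1 - T * (1 + m1 + m2)) / T"
    "q / T / (1 / T) = q"
    using T by (simp_all add: field_simps)
  have Re_T: "Re (T * (1 + m1)) = t + t * l1" "Re (T * (1 + m2)) = t + t * l2"
    "Re (T * m1) = t * l1" "Re (T * m2) = t * l2"
    "Re (T * (2 + m1 + m2)) = 2 * t + t * l1 + t * l2" 
    "Re (T * (1 + m1 + m2)) = t + t * l1 + t * l2" "Re T = t" "Re (2 * q) = 2 * Re q"
    by (simp_all add: T_def m1_def m2_def algebra_simps)
  note strip' = strip[unfolded CM_strip_def]
  have "CM_factors (q / of_real t) (1 / t) (t * l1) (t * l2) =
      Gamma (1 - q)
       * r' (1 - q + T * (1 + m1)) (1 + T * (1 + m1))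
       * r' (1 - q + T * (1 + m2)) (1 + T * (1 + m2))
       * r' (1 - q + T) (1 + T)
       * r' (2 - q + T * (2 + m1 + m2)) (2 - 2 * q + T * (2 + m1 + m2))
       * r' (q + 1 + T) (1 + T)
       * r' (q - T * m1) (- (T * m1))
       * r' (q - T * m2) (- (T * m2))
       * r' (q - 1 - T * (1 + m1 + m2)) (2 * q - 1 - T * (1 + m1 + m2))"
    by (simp only: CM_factors_def Let_def r'_def of_real_divide of_real_mult of_real_1
      T_def [symmetric] m1_def [symmetric] m2_def [symmetric] args)
  also have "r' (1 - q + T * (1 + m1)) (1 + T * (1 + m1)) = 
      E (1 - q + T * (1 + m1)) (1 + T * (1 + m1)) * r (1 - q + T * (1 + m1)) (1 + T * (1 + m1))"
    by (rule r') (use strip' in \<open>auto simp: Re_T simp del: times_complex.sel\<close>)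
  also have "r' (1 - q + T * (1 + m2)) (1 + T * (1 + m2)) = 
      E (1 - q + T * (1 + m2)) (1 + T * (1 + m2)) * r (1 - q + T * (1 + m2)) (1 + T * (1 + m2))"
    by (rule r') (use strip' in \<open>auto simp: Re_T simp del: times_complex.sel\<close>)
  also have "r' (1 - q + T) (1 + T) = E (1 - q + T) (1 + T) * r (1 - q + T) (1 + T)"
    by (rule r') (use strip' in \<open>auto simp: Re_T simp del: times_complex.sel\<close>)
  also have "r' (2 - q + T * (2 + m1 + m2)) (2 - 2 * q + T * (2 + m1 + m2)) = 
      E (2 - q + T * (2 + m1 + m2)) (2 - 2 * q + T * (2 + m1 + m2)) *
      r (2 - q + T * (2 + m1 + m2)) (2 - 2 * q + T * (2 + m1 + m2))"
    by (rule r') (use strip' in \<open>auto simp: Re_T simp del: times_complex.sel\<close>)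
  also have "r' (q + 1 + T) (1 + T) = E (q + 1 + T) (1 + T) * r (q + 1 + T) (1 + T)"
    by (rule r') (use strip' in \<open>auto simp: Re_T simp del: times_complex.sel\<close>)
  also have "r' (q - T * m1) (- (T * m1)) = E (q - T * m1) (- (T * m1)) * r (q - T * m1) (- (T * m1))"
    by (rule r') (use strip' in \<open>auto simp: Re_T simp del: times_complex.sel\<close>)
  also have "r' (q - T * m2) (- (T * m2)) = E (q - T * m2) (- (T * m2)) * r (q - T * m2) (- (T * m2))"
    by (rule r') (use strip' in \<open>auto simp: Re_T simp del: times_complex.sel\<close>)
  also have "r' (q - 1 - T * (1 + m1 + m2)) (2 * q - 1 - T * (1 + m1 + m2)) = 
      E (q - 1 - T * (1 + m1 + m2)) (2 * q - 1 - T * (1 + m1 + m2)) *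
      r (q - 1 - T * (1 + m1 + m2)) (2 * q - 1 - T * (1 + m1 + m2))"
    by (rule r') (use strip' in \<open>auto simp: Re_T simp del: times_complex.sel\<close>)
  finally have 1: "CM_factors (q / of_real t) (1 / t) (t * l1) (t * l2) * Gamma (1 - q / of_real t) =
      (E (1 - q + T * (1 + m1)) (1 + T * (1 + m1))
       * E (1 - q + T * (1 + m2)) (1 + T * (1 + m2))
       * E (1 - q + T) (1 + T)
       * E (2 - q + T * (2 + m1 + m2)) (2 - 2 * q + T * (2 + m1 + m2))
       * E (q + 1 + T) (1 + T)
       * E (q - T * m1) (- (T * m1))
       * E (q - T * m2) (- (T * m2))
       * E (q - 1 - T * (1 + m1 + m2)) (2 * q - 1 - T * (1 + m1 + m2)))
      * CM_factors q t l1 l2 * Gamma (1 - q)"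
    by (simp only: CM_factors_def Let_def r_def T_def [symmetric] m1_def [symmetric] m2_def [symmetric] mult_ac)
  have "Q (1 - q + T * (1 + m1)) (1 + T * (1 + m1))
       + Q (1 - q + T * (1 + m2)) (1 + T * (1 + m2))
       + Q (1 - q + T) (1 + T)
       + Q (2 - q + T * (2 + m1 + m2)) (2 - 2 * q + T * (2 + m1 + m2))
       + Q (q + 1 + T) (1 + T)
       + Q (q - T * m1) (- (T * m1))
       + Q (q - T * m2) (- (T * m2))
       + Q (q - 1 - T * (1 + m1 + m2)) (2 * q - 1 - T * (1 + m1 + m2))
    = (2 * (q * (1 + T))) / (2 * T)"
    unfolding Q_def add_divide_distrib [symmetric]
    by (rule arg_cong[of _ _ "\<lambda>x. x / (2 * T)"]) (simp add: power2_eq_square algebra_simps)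
  hence 2: "E (1 - q + T * (1 + m1)) (1 + T * (1 + m1))
       * E (1 - q + T * (1 + m2)) (1 + T * (1 + m2))
       * E (1 - q + T) (1 + T)
       * E (2 - q + T * (2 + m1 + m2)) (2 - 2 * q + T * (2 + m1 + m2))
       * E (q + 1 + T) (1 + T)
       * E (q - T * m1) (- (T * m1))
       * E (q - T * m2) (- (T * m2))
       * E (q - 1 - T * (1 + m1 + m2)) (2 * q - 1 - T * (1 + m1 + m2)) = 
      exp (of_real (ln t) * (q * (1 + T) / T))"
    unfolding E_def exp_add [symmetric] distrib_left [symmetric] by simp
  show ?thesis unfolding 1 2 by (simp add: T_def)
qed

text \<open>
  The chosen logarithm \<open>g\<close> appears as \<open>- g q / t\<close> in \<open>CM_branch\<close> and as \<open>g q / t\<close> in the extra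
  exponential. The positive constants leave \<open>(1 / t)\<^bsup>t \<cdot> q / t\<^esup> = t\<^sup>-\<^sup>q\<close>.
\<close>

lemma CM_branch_involution:
  assumes strip: "CM_strip q t l1 l2"
  shows "CM_branch g (q / of_real t) (1 / t) (t * l1) (t * l2)
           * exp (q / of_real t * (g - of_real (ln (pi * Gamma t)))) * Gamma (1 - q / of_real t) =
         exp (q * of_real (ln t / t)) * CM_factors q t l1 l2 * Gamma (1 - q)"
proof -
  have t: "t > 0" using strip by (simp add: CM_strip_def)
  have "pi * Gamma t > 0" using t by (intro mult_pos_pos Gamma_real_pos) auto
  hence "ln (Gamma (1 / (1 / t)) * pi * (1 / t) powr (1 / (1 / t))) = ln (pi * Gamma t) - t * ln t"
    using t by (simp add: ln_mult_pos ln_powr ln_div mult_ac)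
  hence "q / of_real t * (of_real (ln (Gamma (1 / (1 / t)) * pi * (1 / t) powr (1 / (1 / t)))) - g)
      + q / of_real t * (g - of_real (ln (pi * Gamma t))) = - q * of_real (ln t)"
    using t by (simp only: of_real_diff of_real_mult) (simp add: field_simps)
  hence "exp (q / of_real t * (of_real (ln (Gamma (1 / (1 / t)) * pi * (1 / t) powr (1 / (1 / t)))) - g))
      * exp (q / of_real t * (g - of_real (ln (pi * Gamma t)))) = exp (- q * of_real (ln t))"
    by (simp only: exp_add [symmetric])
  hence "CM_branch g (q / of_real t) (1 / t) (t * l1) (t * l2)
       * exp (q / of_real t * (g - of_real (ln (pi * Gamma t)))) * Gamma (1 - q / of_real t) =
     exp (- q * of_real (ln t)) * 
       (CM_factors (q / of_real t) (1 / t) (t * l1) (t * l2) * Gamma (1 - q / of_real t))"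
    unfolding CM_branch_def by (simp only: mult_ac)
  also have "\<dots> = exp (- q * of_real (ln t)) * exp (of_real (ln t) * (q * (1 + of_real t) / of_real t)) * 
      CM_factors q t l1 l2 * Gamma (1 - q)"
    by (simp only: CM_factors_scaling[OF strip] mult.assoc)
  also have "exp (- q * of_real (ln t)) * exp (of_real (ln t) * (q * (1 + of_real t) / of_real t)) =
      exp (q * of_real (ln t / t))"
    unfolding exp_add [symmetric]
    by (rule arg_cong[of _ _ exp]) (use t in \<open>simp add: field_simps\<close>)
  finally show ?thesis .
qed

lemma CM_normalised:
  assumes "\<tau> > 1"
  shows "CM q \<tau> l1 l2 * complex_of_real (Gamma (1 - 1 / \<tau>) / (pi * Gamma (1 / \<tau>))) powr q * Gamma (1 - q) =
         exp (q * of_real (ln \<tau> / \<tau>)) * CM_factors q \<tau> l1 l2 * Gamma (1 - q)"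
proof -
  define A B where "A = Gamma (1 / \<tau>)" and "B = Gamma (1 - 1 / \<tau>)"
  have pos: "A > 0" "B > 0"
    using assms by (auto simp: A_def B_def intro!: Gamma_real_pos)
  have "complex_of_real (A * pi * \<tau> powr (1 / \<tau>) / B) powr q * complex_of_real (B / (pi * A)) powr q =
          exp (q * (of_real (ln (A * pi * \<tau> powr (1 / \<tau>) / B) + ln (B / (pi * A)))))"
    using pos assms by (simp add: powr_def Ln_of_real exp_add distrib_left del: of_real_divide of_real_mult)
  also have "ln (A * pi * \<tau> powr (1 / \<tau>) / B) + ln (B / (pi * A)) = ln \<tau> / \<tau>"
    using pos assms by (simp add: ln_mult_pos ln_div ln_powr)
  finally show ?thesis
    unfolding CM_def A_def B_def by (simp only: mult_ac)
qed

lemma tendsto_CM_factors: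
  assumes strip: "CM_strip q \<tau> l1 l2"
  shows "((\<lambda>t. CM_factors q t l1 l2) \<longlongrightarrow> CM_factors q \<tau> l1 l2) (at \<tau>)"
proof -
  note strip' = strip[unfolded CM_strip_def]
  have Re_nonpos: "Re z \<le> 0" if "z \<in> \<int>\<^sub>\<le>\<^sub>0" for z :: complex
    using that by (auto elim!: nonpos_Ints_cases)
  have "Re (1 - q / of_real \<tau>) > 0"
    using strip' by (simp add: Re_divide_of_real)
  hence nonpole: "1 - q / of_real \<tau> \<notin> \<int>\<^sub>\<le>\<^sub>0"
    using Re_nonpos by (meson not_less)
  show ?thesis
    unfolding CM_factors_def Let_def
    by (intro tendsto_intros tendsto_barnes_Gamma2 barnes_Gamma2_nonzero nonpole)
       (use strip' in \<open>auto simp: algebra_simps\<close>)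
qed

lemma eventually_CM_strip:
  assumes "CM_strip q \<tau> l1 l2"
  shows "\<forall>\<^sub>F t in at \<tau>. CM_strip q t l1 l2"
proof -
  have "open {t. CM_strip q t l1 l2}"
    unfolding CM_strip_def
    by (intro open_Collect_conj open_Collect_less continuous_intros)
  from eventually_at_in_open'[OF this] show ?thesis using assms by simp
qed

theorem corollary11p1:
  fixes \<tau> l1 l2 :: real and q :: complex
  assumes "\<tau> > 1"
    and "l1 < 0" and "l2 < 0"
    and "1 + \<tau> * (1 + l1) > 0" and "1 + \<tau> * (1 + l2) > 0"
    and "1 + \<tau> * (l1 + l2) < 0"
    and "max ((1 + \<tau> * (1 + l1 + l2)) / 2) (1 + \<tau> * (1 + l1 + l2)) < Re q"
    and "Re q < min \<tau> (min (1 + \<tau> * (1 + l1)) (1 + \<tau> * (1 + l2)))"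
  shows
    "let lhs = (\<lambda>(g :: complex) (t :: real).
           CM_branch g (q / of_real t) (1 / t) (t * l1) (t * l2)
           * exp (q / of_real t * (g - of_real (ln (pi * Gamma t))))
           * Gamma (1 - q / of_real t));
         rhs = CM q \<tau> l1 l2
           * complex_of_real (Gamma (1 - 1 / \<tau>) / (pi * Gamma (1 / \<tau>))) powr q
           * Gamma (1 - q)
     in (\<tau> \<notin> \<int> \<longrightarrow>
           (\<forall>g. exp g = complex_of_real (Gamma (1 - \<tau>)) \<longrightarrow> lhs g \<tau> = rhs))
      \<and> (\<tau> \<in> \<int> \<longrightarrow>
           (\<forall>g :: real \<Rightarrow> complex.
              (\<forall>\<^sub>F t in at \<tau>. exp (g t) = complex_of_real (Gamma (1 - t))) \<longrightarrow>
              ((\<lambda>t. lhs (g t) t) \<longlongrightarrow> rhs) (at \<tau>)))"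
proof -
  define lhs where "lhs = (\<lambda>(g :: complex) (t :: real).
           CM_branch g (q / of_real t) (1 / t) (t * l1) (t * l2)
           * exp (q / of_real t * (g - of_real (ln (pi * Gamma t))))
           * Gamma (1 - q / of_real t))"
  define rhs where "rhs = CM q \<tau> l1 l2
           * complex_of_real (Gamma (1 - 1 / \<tau>) / (pi * Gamma (1 / \<tau>))) powr q
           * Gamma (1 - q)"
  define common where "common t = exp (q * of_real (ln t / t)) * CM_factors q t l1 l2 * Gamma (1 - q)" for t
  have strip: "CM_strip q \<tau> l1 l2"
    using assms by (auto simp: CM_strip_def algebra_simps mult_pos_neg)
  have rhs: "rhs = common \<tau>"
    unfolding rhs_def common_def using assms(1) by (rule CM_normalised)
  have lhs: "lhs g t = common t" if "CM_strip q t l1 l2" for g t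
    unfolding lhs_def common_def using that by (rule CM_branch_involution)
  have "((\<lambda>t. lhs (g t) t) \<longlongrightarrow> rhs) (at \<tau>)" for g
  proof (rule Lim_transform_eventually)
    show "(common \<longlongrightarrow> rhs) (at \<tau>)"
      unfolding rhs common_def using assms(1)
      by (intro tendsto_intros tendsto_CM_factors strip) auto
    show "\<forall>\<^sub>F t in at \<tau>. common t = lhs (g t) t"
      using eventually_CM_strip[OF strip] by eventually_elim (simp add: lhs)
  qed
  moreover have "lhs g \<tau> = rhs" for g
    using strip by (simp add: lhs rhs)
  ultimately show ?thesis
    unfolding lhs_def rhs_def Let_def by blast
qed

end
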